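(* For every integer $k \ge 1$ there is a constant $c_k > 0$, depending only on $k$, such that the following holds. Let $0 < \epsilon < 1$, let $A \subset \mathbb{Z}$ be a finite non-empty set, and let $$K_* := \frac{|AA|}{|A|}.$$ Then $$|kA| \geq c_k\, |A|^{k - 2\epsilon k \log_2 k}\, K_*^{-2k/\epsilon}.$$
   Context: $AA = \{ab : a,b \in A\}$ is the product set, $kA = \underbrace{A+\ldots+A}_{k \text{ times}} = \{a_1+\cdots+a_k : a_1,\ldots,a_k \in A\}$ is the $k$-fold sumset, and $|X|$ denotes the cardinality of $X$. *)

theory Defs
  imports "HOL-Analysis.Analysis" "HOL-Library.Set_Algebras"
begin

(* On sets, + and * are the Minkowski operations of Set_Algebras, so A * A is the product set AA.
   The sum below is one of sets: A + ... + A with k summands (and {0} for k = 0). *)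
definition sumset :: "nat \<Rightarrow> 'a::comm_monoid_add set \<Rightarrow> 'a set"
  where "sumset k A = (\<Sum>i=1..k. A)"

lemma sumset_altdef: "sumset k A = {(\<Sum>i=1..k. a i) |a. \<forall>i\<in>{1..k}. a i \<in> A}"
  unfolding sumset_def by (rule set_sum_alt) simp

end

theory Submission
  imports Defs
begin

text \<open>
  A set of integers with few products has little multiplicative freedom: a large part of it can
  be identified by asking for a few $p$-adic valuations.  A set that can be identified in this way
  is, in turn, close to being dissociated for addition, so that it has many sums.  The proof makes
  both halves quantitative through one notion of complexity: a set has \<^emph>\<open>query depth\<close> at most $t$ if
  each of its elements is determined up to sign by at most $t$ valuations, where the prime that
  is queried may depend on the earlier answers.

  \<^emph>\<open>Few products give small query depth\<close> (\<open>exists_large_subset_query_depth_le\<close>): for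
  $0 < \epsilon \le 1/4$, a set $A$ of nonzero integers with $|AA| = K|A|$ contains a set $B$ with
  $|B| \ge K^{-2/\epsilon}|A|$ and query depth at most $\epsilon \log_2 |A|$.  Let $F(A)$ be the
  largest size of such a subset.  The inequality to prove is
  $|AB| \ge (\Phi(A)\Phi(B))^{1/2}$ with the potential
  $\Phi(A) = |A|^{1+\epsilon/2} F(A)^{-\epsilon/2}$, since $A = B$ then gives
  $K \ge (|A|/F(A))^{\epsilon/2}$.  It is proved by induction on $|A| + |B|$.  Splitting $A$ and $B$
  into the fibers of a valuation turns products into sums of indices, and the induction hypothesis
  bounds the fibers of $AB$ from below; a discrete Prekopa-Leindler inequality
  (\<open>sum_over_sumset_ge\<close>) sums these bounds.  It remains to compare the potential of $A$ with those
  of its fibers (\<open>potential_le_fibers\<close>).  If every fiber has at most $2^{-1/\epsilon}|A|$ elements,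
  then one query is affordable, because the bound $\epsilon \log_2$ of the size drops by one on every
  fiber; no potential is lost, by Hoelder's inequality.  If there is a larger fiber, no query is
  made and the size of $A$ drops to that of a fiber; this is paid for by the gain of almost a factor
  two in the inequality $|I + J| \ge |I| + |J| - 1$.

  \<^emph>\<open>Small query depth gives many sums\<close> (\<open>card_sumset_ge_query_depth\<close>): query depth at most $t$ implies
  $|kB| \ge |B|^k / (2k^{2t})^k$.  This is a bound for the $2k$-th moment of the exponential sum over
  $B$.  A query decomposes this sum into martingale differences: a suitable shift of the argument
  leaves the part with higher valuation unchanged, while each exponential with lower valuation
  averages to zero along the shifts.  Hence the squares of the $L^{2k}$ norms of the parts add up,
  apart from a factor $k^2$ (\<open>moment_le_Un\<close>), and every query costs such a factor.

  For $t \le \epsilon \log_2|A|$ the loss $k^{2tk}$ is at most $|A|^{2 \epsilon k \log_2 k}$, which gives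
  the theorem when $0 \notin A$ and $\epsilon \le 1/4$.  For larger $\epsilon$ the asserted bound is at
  most $|A| \le |kA|$.  Omitting zero changes $K$ by a factor of about $1 + 1/|A|$, which
  is harmless as long as $1/\epsilon \le \log_2 |A|$; a smaller $\epsilon$ can be replaced by
  $1/\log_2 |A|$, since this changes the power of $|A|$ only by a factor that depends on $k$.
\<close>

section \<open>Sums over sumsets of indices\<close>

text \<open>
  The translates $\min I + J$ and $I + \max J$ have only one element in common.
\<close>

lemma card_set_plus_ge:
  fixes I J :: "'a::linordered_cancel_ab_semigroup_add set"
  assumes "finite I" "finite J" "I \<noteq> {}" "J \<noteq> {}"
  shows "card I + card J \<le> card (I + J) + 1"
proof -
  define m M where "m = Min I" and "M = Max J"
  have m: "m \<in> I" "\<And>i. i \<in> I \<Longrightarrow> m \<le> i" and M: "M \<in> J" "\<And>j. j \<in> J \<Longrightarrow> j \<le> M"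
    using assms by (auto simp: m_def M_def)
  have "(\<lambda>j. m + j) ` J \<inter> (\<lambda>i. i + M) ` I \<subseteq> {m + M}"
  proof clarify
    fix j i assume "j \<in> J" "i \<in> I" and eq: "m + j = i + M"
    have "m + j \<le> m + M" using M(2)[OF \<open>j \<in> J\<close>] by (rule add_left_mono)
    moreover have "m + M \<le> i + M" using m(2)[OF \<open>i \<in> I\<close>] by (rule add_right_mono)
    ultimately show "m + j = m + M" using eq by simp
  qed
  then have "card ((\<lambda>j. m + j) ` J \<inter> (\<lambda>i. i + M) ` I) \<le> 1"
    by (metis card_mono finite.emptyI finite.insertI is_singletonI is_singleton_altdef)
  moreover have "card ((\<lambda>j. m + j) ` J \<union> (\<lambda>i. i + M) ` I) \<le> card (I + J)"
    using m M assms by (intro card_mono finite_set_plus) auto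
  moreover have "card ((\<lambda>j. m + j) ` J) = card J" "card ((\<lambda>i. i + M) ` I) = card I"
    by (auto intro!: card_image inj_onI)
  ultimately show ?thesis
    using card_Un_Int[of "(\<lambda>j. m + j) ` J" "(\<lambda>i. i + M) ` I"] assms by simp
qed

text \<open>
  A discrete Prekopa-Leindler inequality with additive gain.  Its reason is the layer-cake formula:
  the level set of $c$ at height $h$ contains the sumset of the level sets of $f$ and $g$, and
  these are nonempty for every $h \le T$.  The induction removes the lowest layer.
\<close>

lemma sum_over_sumset_ge:
  fixes I J :: "'a::linordered_cancel_ab_semigroup_add set" and f g c :: "'a \<Rightarrow> real"
  assumes "finite I" "finite J"
    and "i0 \<in> I" "f i0 = T" "\<And>i. i \<in> I \<Longrightarrow> f i \<le> T"
    and "j0 \<in> J" "g j0 = T" "\<And>j. j \<in> J \<Longrightarrow> g j \<le> T"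
    and "\<And>i. i \<in> I \<Longrightarrow> 0 \<le> f i" "\<And>j. j \<in> J \<Longrightarrow> 0 \<le> g j"
    and "\<And>i j. i \<in> I \<Longrightarrow> j \<in> J \<Longrightarrow> min (f i) (g j) \<le> c (i + j)"
  shows "sum f I + sum g J - T \<le> sum c (I + J)"
  using assms
proof (induction "card I + card J" arbitrary: I J f g c T rule: less_induct)
  case less
  note fin = less.prems(1,2)
  define m where "m = min (Min (f ` I)) (Min (g ` J))"
  have ne: "I \<noteq> {}" "J \<noteq> {}" using less.prems by auto
  have mf: "m \<le> f i" if "i \<in> I" for i using that fin by (auto simp: m_def min_le_iff_disj)
  have mg: "m \<le> g j" if "j \<in> J" for j using that fin by (auto simp: m_def min_le_iff_disj)
  have "Min (f ` I) \<in> f ` I" "Min (g ` J) \<in> g ` J" using fin ne by (auto intro!: Min_in)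
  then have m_attained: "(\<exists>i\<in>I. f i = m) \<or> (\<exists>j\<in>J. g j = m)"
    unfolding m_def min_def by auto
  have m0: "0 \<le> m" using m_attained less.prems(9,10) by auto
  have c_ge: "m \<le> c s" if "s \<in> I + J" for s
  proof -
    obtain i j where "i \<in> I" "j \<in> J" "s = i + j" using \<open>s \<in> I + J\<close> by (rule set_plus_elim)
    then show ?thesis using less.prems(11)[of i j] mf[of i] mg[of j] by simp
  qed
  have card: "real (card I) + card J - 1 \<le> card (I + J)"
    using card_set_plus_ge[OF fin ne] by linarith
  have finS: "finite (I + J)" using fin by (rule finite_set_plus)
  show ?case
  proof (cases "m = T")
    case True
    have "f i = T" if "i \<in> I" for i using mf[OF that] less.prems(5)[OF that] True by simp
    then have "sum f I = (\<Sum>i\<in>I. T)" by (rule sum.cong[OF refl])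
    moreover have "g j = T" if "j \<in> J" for j using mg[OF that] less.prems(8)[OF that] True by simp
    then have "sum g J = (\<Sum>j\<in>J. T)" by (rule sum.cong[OF refl])
    ultimately have "sum f I + sum g J - T = T * (real (card I) + card J - 1)"
      by (simp add: algebra_simps)
    also have "\<dots> \<le> T * card (I + J)" using card m0 True by (intro mult_left_mono) auto
    also have "\<dots> = (\<Sum>s\<in>I + J. T)" by simp
    also have "\<dots> \<le> sum c (I + J)" using c_ge True by (intro sum_mono) auto
    finally show ?thesis .
  next
    case False
    then have "m < T" using mf[OF less.prems(3)] less.prems(4) by auto
    \<comment> \<open>What remains above the lowest layer of height \<open>m\<close>.\<close>
    define I' J' where "I' = {i\<in>I. m < f i}" and "J' = {j\<in>J. m < g j}"
    have sub: "I' \<subseteq> I" "J' \<subseteq> J" by (auto simp: I'_def J'_def)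
    have fin': "finite I'" "finite J'" using sub fin by (auto intro: finite_subset)
    have "card I' < card I \<or> card J' < card J"
      using m_attained fin by (auto simp: I'_def J'_def intro!: psubset_card_mono)
    moreover have "card I' \<le> card I" "card J' \<le> card J"
      using sub fin by (simp_all add: card_mono)
    ultimately have smaller: "card I' + card J' < card I + card J" by linarith
    have IH: "(\<Sum>i\<in>I'. f i - m) + (\<Sum>j\<in>J'. g j - m) - (T - m) \<le> (\<Sum>s\<in>I' + J'. c s - m)"
    proof (rule less.hyps[OF smaller fin'])
      show "i0 \<in> I'" "j0 \<in> J'" using less.prems(3,4,6,7) \<open>m < T\<close> by (simp_all add: I'_def J'_def)
      show "f i0 - m = T - m" "g j0 - m = T - m" using less.prems(4,7) by simp_all
      show "f i - m \<le> T - m" "0 \<le> f i - m" if "i \<in> I'" for i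
        using that less.prems(5) mf by (simp_all add: I'_def)
      show "g j - m \<le> T - m" "0 \<le> g j - m" if "j \<in> J'" for j
        using that less.prems(8) mg by (simp_all add: J'_def)
      show "min (f i - m) (g j - m) \<le> c (i + j) - m" if "i \<in> I'" "j \<in> J'" for i j
        using less.prems(11)[of i j] that by (simp add: I'_def J'_def min_le_iff_disj)
    qed
    have "(\<Sum>i\<in>I'. f i - m) = (\<Sum>i\<in>I. f i - m)" "(\<Sum>j\<in>J'. g j - m) = (\<Sum>j\<in>J. g j - m)"
      using fin sub mf mg by (intro sum.mono_neutral_left; fastforce simp: I'_def J'_def)+
    moreover have "(\<Sum>s\<in>I' + J'. c s - m) \<le> (\<Sum>s\<in>I + J. c s - m)"
      using finS c_ge sub by (intro sum_mono2) (auto simp: set_plus_mono2)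
    ultimately have "sum f I - m * card I + (sum g J - m * card J) - (T - m) \<le> sum c (I + J) - m * card (I + J)"
      using IH by (simp add: sum_subtractf mult.commute)
    moreover have "m * (real (card I) + card J - 1) \<le> m * card (I + J)"
      using card m0 by (rule mult_left_mono)
    ultimately show ?thesis by (simp add: algebra_simps)
  qed
qed

section \<open>Query depth\<close>

definition fiber :: "int \<Rightarrow> int set \<Rightarrow> nat \<Rightarrow> int set"
  where "fiber p A i = {x \<in> A. multiplicity p x = i}"

text \<open>
  The valuations of a nonzero integer determine it only up to sign; hence the absolute values in
  the base case.
\<close>

primrec query_depth_le :: "nat \<Rightarrow> int set \<Rightarrow> bool" where
  "query_depth_le 0 A \<longleftrightarrow> (\<forall>x\<in>A. \<forall>y\<in>A. \<bar>x\<bar> = \<bar>y\<bar>)"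
| "query_depth_le (Suc t) A \<longleftrightarrow>
     query_depth_le t A \<or> (\<exists>p. prime p \<and> (\<forall>i. query_depth_le t (fiber p A i)))"

lemma query_depth_le_mono:
  assumes "query_depth_le s A" "s \<le> t"
  shows "query_depth_le t A"
  using assms(2,1) by (induction t rule: dec_induct) simp_all

lemma query_depth_le_empty [simp]: "query_depth_le t {}"
proof -
  have "query_depth_le 0 {}" by simp
  then show ?thesis by (rule query_depth_le_mono) simp
qed

lemma fiber_subset: "fiber p A i \<subseteq> A"
  by (auto simp: fiber_def)

lemma sum_card_fibers:
  assumes "finite A" "finite I" "multiplicity p ` A \<subseteq> I"
  shows "(\<Sum>i\<in>I. card (fiber p A i)) = card A"
proof -
  have "A = (\<Union>i\<in>I. fiber p A i)" using assms by (auto simp: fiber_def)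
  then have "card A = card (\<Union>i\<in>I. fiber p A i)" by (rule arg_cong)
  also have "\<dots> = (\<Sum>i\<in>I. card (fiber p A i))"
    using assms by (intro card_UN_disjoint) (auto simp: fiber_def)
  finally show ?thesis by simp
qed

definition budget :: "real \<Rightarrow> int set \<Rightarrow> nat"
  where "budget \<epsilon> A = nat \<lfloor>\<epsilon> * log 2 (card A)\<rfloor>"

text \<open>
  The quantity $F(A)$ of the introduction.  The number of queries is measured by the size of the
  ambient set, so that passing to a small fiber pays for a query.
\<close>

definition core_size :: "real \<Rightarrow> int set \<Rightarrow> nat"
  where "core_size \<epsilon> A = Max {card B |B. B \<subseteq> A \<and> query_depth_le (budget \<epsilon> A) B}"

lemma
  assumes "finite A"
  shows core_size_attained: "\<exists>B\<subseteq>A. query_depth_le (budget \<epsilon> A) B \<and> card B = core_size \<epsilon> A"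
    and core_size_ge: "B \<subseteq> A \<Longrightarrow> query_depth_le t B \<Longrightarrow> t \<le> budget \<epsilon> A \<Longrightarrow> card B \<le> core_size \<epsilon> A"
proof -
  let ?S = "{card B |B. B \<subseteq> A \<and> query_depth_le (budget \<epsilon> A) B}"
  have "?S \<subseteq> card ` Pow A" by auto
  then have fin: "finite ?S" using assms finite_subset by blast
  have "{} \<subseteq> A \<and> query_depth_le (budget \<epsilon> A) {}" by simp
  then have "card ({} :: int set) \<in> ?S" by blast
  then have "?S \<noteq> {}" by blast
  then have "Max ?S \<in> ?S" using fin by (rule Max_in[rotated])
  then show "\<exists>B\<subseteq>A. query_depth_le (budget \<epsilon> A) B \<and> card B = core_size \<epsilon> A"
    by (auto simp: core_size_def)
  assume "B \<subseteq> A" "query_depth_le t B" "t \<le> budget \<epsilon> A"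
  then have "B \<subseteq> A \<and> query_depth_le (budget \<epsilon> A) B" by (simp add: query_depth_le_mono)
  then have "card B \<in> ?S" by blast
  then show "card B \<le> core_size \<epsilon> A" unfolding core_size_def by (rule Max_ge[OF fin])
qed

lemma core_size_le_card:
  assumes "finite A"
  shows "core_size \<epsilon> A \<le> card A"
proof -
  obtain B where "B \<subseteq> A" "card B = core_size \<epsilon> A" using core_size_attained[OF assms] by blast
  then show ?thesis using card_mono[OF assms, of B] by simp
qed

lemma core_size_pos:
  assumes "finite A" "A \<noteq> {}"
  shows "0 < core_size \<epsilon> A"
proof -
  obtain a where "a \<in> A" using assms by auto
  then show ?thesis using core_size_ge[OF assms(1), of "{a}" 0 \<epsilon>] by simp
qed

lemma core_size_mono:
  assumes "finite A" "B \<subseteq> A" "B \<noteq> {}" "0 < \<epsilon>"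
  shows "core_size \<epsilon> B \<le> core_size \<epsilon> A"
proof -
  have fB: "finite B" using assms(2,1) by (rule finite_subset)
  have "card B \<le> card A" "0 < card B" using assms(3) fB card_mono[OF assms(1,2)] by (simp_all add: card_gt_0_iff)
  then have "budget \<epsilon> B \<le> budget \<epsilon> A"
    unfolding budget_def using assms by (intro nat_mono floor_mono mult_left_mono) auto
  moreover obtain C where "C \<subseteq> B" "query_depth_le (budget \<epsilon> B) C" "card C = core_size \<epsilon> B"
    using core_size_attained[OF fB, of \<epsilon>] by blast
  ultimately show ?thesis
    using core_size_ge[OF assms(1), of C "budget \<epsilon> B" \<epsilon>] assms(2) by simp
qed

text \<open>
  If all fibers of a valuation are light, then the bound on the number of queries is smaller by at
  least one on each fiber.  The optimal subsets of the fibers can therefore be joined by one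
  additional query.
\<close>

lemma core_size_ge_sum_fibers:
  assumes A: "finite A" and "prime p" and "0 < \<epsilon>"
    and light: "\<And>i. i \<in> multiplicity p ` A \<Longrightarrow> real (card (fiber p A i)) \<le> 2 powr (- (1 / \<epsilon>)) * card A"
  shows "(\<Sum>i\<in>multiplicity p ` A. core_size \<epsilon> (fiber p A i)) \<le> core_size \<epsilon> A"
proof (cases "A = {}")
  case False
  let ?I = "multiplicity p ` A"
  have fin: "finite (fiber p A i)" for i using fiber_subset A by (rule finite_subset)
  have budget: "Suc (budget \<epsilon> (fiber p A i)) \<le> budget \<epsilon> A" if i: "i \<in> ?I" for i
  proof -
    have pos: "0 < card (fiber p A i)" using fin i by (auto simp: card_gt_0_iff fiber_def)
    have "log 2 (card (fiber p A i)) \<le> log 2 (2 powr (- (1 / \<epsilon>)) * card A)"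
      using light[OF i] pos by (intro log_mono) auto
    also have "\<dots> = - (1 / \<epsilon>) + log 2 (card A)"
      using A False by (subst log_mult) (auto simp: card_gt_0_iff)
    finally have "\<epsilon> * log 2 (card (fiber p A i)) \<le> \<epsilon> * log 2 (card A) - 1"
      using \<open>0 < \<epsilon>\<close> by (simp add: field_simps)
    moreover have "0 \<le> \<epsilon> * log 2 (card (fiber p A i))" using pos \<open>0 < \<epsilon>\<close> by auto
    ultimately show ?thesis unfolding budget_def by linarith
  qed
  have "\<forall>i. \<exists>B\<subseteq>fiber p A i. query_depth_le (budget \<epsilon> (fiber p A i)) B \<and> card B = core_size \<epsilon> (fiber p A i)"
    using core_size_attained[OF fin] by blast
  then obtain B where B: "\<And>i. B i \<subseteq> fiber p A i"
    "\<And>i. query_depth_le (budget \<epsilon> (fiber p A i)) (B i)" "\<And>i. card (B i) = core_size \<epsilon> (fiber p A i)"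
    by metis
  define U where "U = (\<Union>i\<in>?I. B i)"
  have mult_B: "multiplicity p x = i" if "x \<in> B i" for x i
    using B(1) that by (auto simp: fiber_def)
  have fibU: "fiber p U i = (if i \<in> ?I then B i else {})" for i
    using mult_B by (auto simp: U_def fiber_def)
  obtain t where t: "budget \<epsilon> A = Suc t"
    using budget False by (metis Suc_le_D equals0I imageI)
  have "query_depth_le t (fiber p U i)" for i
    using B(2)[of i] budget[of i] t by (auto simp: fibU intro: query_depth_le_mono)
  then have "query_depth_le (budget \<epsilon> A) U" using \<open>prime p\<close> t by auto
  moreover have "U \<subseteq> A" using B(1) fiber_subset unfolding U_def by blast
  ultimately have "card U \<le> core_size \<epsilon> A" using A by (intro core_size_ge) auto
  moreover have "card U = (\<Sum>i\<in>?I. card (B i))"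
    unfolding U_def
  proof (rule card_UN_disjoint)
    show "\<forall>i\<in>?I. finite (B i)" using finite_subset[OF B(1) fin] by blast
    show "\<forall>i\<in>?I. \<forall>j\<in>?I. i \<noteq> j \<longrightarrow> B i \<inter> B j = {}"
    proof (intro ballI impI equals0I)
      fix i j x assume "i \<noteq> j" "x \<in> B i \<inter> B j"
      then show False using mult_B[of x i] mult_B[of x j] by simp
    qed
  qed (use A in auto)
  ultimately show ?thesis using B(3) by simp
qed simp

section \<open>Real inequalities for light and heavy fibers\<close>

text \<open>
  Hoelder's inequality in the form of Jensen's inequality for $x^{1+\delta}$ at the points
  $a_i/b_i$ with weights proportional to $b_i$.
\<close>

lemma sum_powr_div_powr_ge:
  fixes a b :: "'a \<Rightarrow> real"
  assumes "finite I" "I \<noteq> {}" "0 \<le> \<delta>"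
    and a: "\<And>i. i \<in> I \<Longrightarrow> 0 < a i" and b: "\<And>i. i \<in> I \<Longrightarrow> 0 < b i"
  shows "sum a I powr (1 + \<delta>) * sum b I powr (- \<delta>) \<le> (\<Sum>i\<in>I. a i powr (1 + \<delta>) * b i powr (- \<delta>))"
proof -
  define S where "S = sum b I"
  have S: "0 < S" unfolding S_def using assms by (intro sum_pos) auto
  have apos: "0 < sum a I" using assms by (intro sum_pos) auto
  have "(\<Sum>i\<in>I. (b i / S) *\<^sub>R (a i / b i)) powr (1 + \<delta>) \<le> (\<Sum>i\<in>I. (b i / S) * (a i / b i) powr (1 + \<delta>))"
  proof (rule convex_on_sum)
    show "convex_on {0<..} (\<lambda>x. x powr (1 + \<delta>))" using \<open>0 \<le> \<delta>\<close> by (intro powr_convex) auto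
    show "(\<Sum>i\<in>I. b i / S) = 1" using S by (simp add: S_def flip: sum_divide_distrib)
  qed (use assms S in \<open>auto simp: less_imp_le\<close>)
  also have "(\<Sum>i\<in>I. (b i / S) *\<^sub>R (a i / b i)) = sum a I / S"
    using b by (auto simp: sum_divide_distrib less_imp_neq[symmetric] intro!: sum.cong)
  also have "(\<Sum>i\<in>I. (b i / S) * (a i / b i) powr (1 + \<delta>)) = (\<Sum>i\<in>I. a i powr (1 + \<delta>) * b i powr (- \<delta>)) / S"
    unfolding sum_divide_distrib
    by (rule sum.cong) (use a b in \<open>auto simp: powr_divide powr_add powr_minus less_imp_le field_simps\<close>)
  finally have "S * (sum a I / S) powr (1 + \<delta>) \<le> (\<Sum>i\<in>I. a i powr (1 + \<delta>) * b i powr (- \<delta>))"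
    using S by (simp add: field_simps)
  also have "S * (sum a I / S) powr (1 + \<delta>) = sum a I powr (1 + \<delta>) * S powr (- \<delta>)"
    using S apos by (simp add: powr_divide powr_add powr_minus field_simps)
  finally show ?thesis by (simp add: S_def)
qed

text \<open>
  With $w = r^{(1+\delta)/6}$ the right-hand side is $w^3/2 + w^6$, while $r \le w^5$ because
  $5(1+\delta)/6 \le 1$; the remaining polynomial inequality has a double root at $w = 1$.
\<close>

lemma three_halves_mult_le_powr:
  fixes r \<delta> :: real
  assumes "0 < r" "r \<le> 1" "0 \<le> \<delta>" "\<delta> \<le> 1/8"
  shows "3/2 * r \<le> 1/2 * r powr ((1 + \<delta>) / 2) + r powr (1 + \<delta>)"
proof -
  define w where "w = r powr ((1 + \<delta>) / 6)"
  have w: "0 < w" "w ^ 3 = r powr ((1 + \<delta>) / 2)" "w ^ 6 = r powr (1 + \<delta>)" "w ^ 5 = r powr (5 * (1 + \<delta>) / 6)"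
  proof -
    have w_power: "w ^ n = r powr (n * (1 + \<delta>) / 6)" for n
      using assms by (simp add: w_def powr_power mult.commute)
    show "0 < w" using assms by (simp add: w_def)
    show "w ^ 3 = r powr ((1 + \<delta>) / 2)" "w ^ 6 = r powr (1 + \<delta>)" "w ^ 5 = r powr (5 * (1 + \<delta>) / 6)"
      unfolding w_power by (rule arg_cong[where f = "(powr) r"]; simp)+
  qed
  have "r powr 1 \<le> r powr (5 * (1 + \<delta>) / 6)"
    using assms by (intro powr_mono') auto
  then have "r \<le> w ^ 5" using assms w by simp
  moreover have "0 \<le> 1/2 * w ^ 3 * ((1 - w)\<^sup>2 * (1 + 2 * w))"
    using w(1) by (intro mult_nonneg_nonneg) auto
  moreover have "1/2 * w ^ 3 * ((1 - w)\<^sup>2 * (1 + 2 * w)) = 1/2 * w ^ 3 + w ^ 6 - 3/2 * w ^ 5"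
    by (simp add: power2_eq_square eval_nat_numeral algebra_simps)
  ultimately show ?thesis using w by linarith
qed

text \<open>
  The right-hand side is a line of slope larger than $\sqrt 2$ that meets $u^{1+\delta}$ at
  $u = 1$.  In the range allowed by the last hypothesis, $u^{1+\delta} \le \sqrt 2\, u$, which
  settles all large $u$; for small $u$ the bound $\delta \le 1/8$ is enough.
\<close>

lemma powr_le_linear:
  fixes u \<delta> :: real
  assumes "1 \<le> u" "0 \<le> \<delta>" "\<delta> \<le> 1/8" "u powr \<delta> \<le> sqrt 2"
  shows "u powr (1 + \<delta>) \<le> 3/2 * u - 1/2"
proof -
  have "u powr \<delta> \<le> 3/2 - 1/2 / u"
  proof -
    consider "u \<le> 4" | "4 < u" "u \<le> 6" | "6 < u" by linarith
    then show ?thesis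
    proof cases
      case 1
      have "u powr \<delta> * 1 powr (1 - \<delta>) \<le> \<delta> * u + (1 - \<delta>) * 1"
        using assms by (intro Youngs_inequality_0) auto
      then have "u powr \<delta> \<le> 1 + \<delta> * (u - 1)" by (simp add: algebra_simps)
      also have "\<dots> \<le> 1 + 1/8 * (u - 1)" using assms by (intro add_left_mono mult_right_mono) auto
      also have "\<dots> \<le> 3/2 - 1/2 / u"
      proof -
        have "0 \<le> (u - 1) * (4 - u)" using 1 assms by (intro mult_nonneg_nonneg) auto
        then show ?thesis using assms by (simp add: field_simps)
      qed
      finally show ?thesis .
    next
      case 2
      have "u powr \<delta> \<le> u powr (1/8)" using assms by (intro powr_mono) auto
      also have "\<dots> \<le> ((11/8) ^ 8) powr (1/8)"
        using 2 by (intro powr_mono2) (auto simp: power_divide)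
      also have "\<dots> = (11/8 :: real)" by (simp add: powr_powr flip: powr_numeral)
      also have "11/8 \<le> 3/2 - 1/2 / u" using 2 by (simp add: field_simps)
      finally show ?thesis .
    next
      case 3
      have "sqrt 2 \<le> 17/12" by (intro real_le_lsqrt) (auto simp: power2_eq_square)
      also have "17/12 \<le> 3/2 - 1/2 / u" using 3 by (simp add: field_simps)
      finally show ?thesis using assms by linarith
    qed
  qed
  then have "u * u powr \<delta> \<le> u * (3/2 - 1/2 / u)" using assms by (intro mult_left_mono) auto
  then show ?thesis using assms by (simp add: powr_add algebra_simps)
qed

text \<open>
  The case of a heavy fiber, with the fiber sizes normalised by the largest one.  The right-hand side
  is the mean of two lower bounds for a sumset: the row through the largest element, and the layer-cake
  bound $2 \sum r_i^{1+\delta} - 1$.  Neither suffices alone: the row is too short when all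
  $r_i = 1$, and the layer-cake bound is too small when there are many tiny $r_i$.
\<close>

lemma powr_sum_le_mixed_sum:
  fixes r :: "'a \<Rightarrow> real"
  assumes "finite I" "i0 \<in> I" "r i0 = 1"
    and r: "\<And>i. i \<in> I \<Longrightarrow> 0 < r i" "\<And>i. i \<in> I \<Longrightarrow> r i \<le> 1"
    and \<delta>: "0 \<le> \<delta>" "\<delta> \<le> 1/8" and "sum r I powr \<delta> \<le> sqrt 2"
  shows "sum r I powr (1 + \<delta>) \<le>
    1/2 * ((\<Sum>i\<in>I. r i powr ((1 + \<delta>) / 2)) + 2 * (\<Sum>i\<in>I. r i powr (1 + \<delta>)) - 1)"
proof -
  have split: "sum h I = h i0 + sum h (I - {i0})" for h :: "'a \<Rightarrow> real"
    using assms by (simp add: sum.remove)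
  have "1 \<le> sum r I" using member_le_sum[of i0 I r] assms by (auto simp: less_imp_le)
  then have "sum r I powr (1 + \<delta>) \<le> 3/2 * sum r I - 1/2" using assms by (intro powr_le_linear)
  also have "\<dots> = 1 + (\<Sum>i\<in>I - {i0}. 3/2 * r i)"
    unfolding sum_distrib_left[symmetric] using assms by (simp add: split field_simps)
  also have "\<dots> \<le> 1 + (\<Sum>i\<in>I - {i0}. 1/2 * r i powr ((1 + \<delta>) / 2) + r i powr (1 + \<delta>))"
    using r \<delta> by (intro add_left_mono sum_mono three_halves_mult_le_powr) auto
  also have "\<dots> = 1/2 * ((\<Sum>i\<in>I. r i powr ((1 + \<delta>) / 2)) + 2 * (\<Sum>i\<in>I. r i powr (1 + \<delta>)) - 1)"
    using assms by (simp add: split sum.distrib flip: sum_divide_distrib)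
  finally show ?thesis .
qed

section \<open>Few products force a large subset of small query depth\<close>

definition potential :: "real \<Rightarrow> int set \<Rightarrow> real"
  where "potential \<epsilon> A = card A powr (1 + \<epsilon> / 2) * core_size \<epsilon> A powr (- (\<epsilon> / 2))"

text \<open>
  The right-hand side is built so that the geometric mean of its values for $A$ and $B$ is at most
  $|AB|$; here \<open>i1\<close> is the fiber of largest potential.  It is monotone in the
  potentials of the fibers; in the heavy case these are replaced by lower bounds in which
  the core size of every fiber is that of $A$.
\<close>

lemma potential_le_fibers:
  assumes A: "finite A" "A \<noteq> {}" and p: "prime p" and \<epsilon>: "0 < \<epsilon>" "\<epsilon> \<le> 1/4"
    and I_def: "I = multiplicity p ` A" and f_def: "f = (\<lambda>i. potential \<epsilon> (fiber p A i))"
    and i1: "i1 \<in> I" and M: "\<And>i. i \<in> I \<Longrightarrow> f i \<le> f i1"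
  shows "potential \<epsilon> A \<le> 1/2 * (sqrt (f i1) * (\<Sum>i\<in>I. sqrt (f i)) + 2 * sum f I - f i1)"
proof -
  define \<delta> where "\<delta> = \<epsilon> / 2"
  define a where "a i = real (card (fiber p A i))" for i
  define F where "F = real (core_size \<epsilon> A)"
  have finI: "finite I" and neI: "I \<noteq> {}" using A by (auto simp: I_def)
  have fin: "finite (fiber p A i)" for i using fiber_subset A(1) by (rule finite_subset)
  have ne: "fiber p A i \<noteq> {}" if "i \<in> I" for i using that by (auto simp: I_def fiber_def)
  have apos: "0 < a i" if "i \<in> I" for i using ne[OF that] fin by (simp add: a_def card_gt_0_iff)
  have Fpos: "0 < F" using core_size_pos[OF A] by (simp add: F_def)
  have suma: "sum a I = card A"
    using sum_card_fibers[OF A(1) finI, of p] by (simp add: a_def I_def flip: of_nat_sum)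
  have f: "f i = a i powr (1 + \<delta>) * core_size \<epsilon> (fiber p A i) powr (- \<delta>)" for i
    by (simp add: f_def potential_def a_def \<delta>_def)
  have f0: "0 \<le> f i" for i by (simp add: f)
  have pot: "potential \<epsilon> A = sum a I powr (1 + \<delta>) * F powr (- \<delta>)"
    by (simp add: potential_def suma \<delta>_def F_def)
  show ?thesis
  proof (cases "\<forall>i\<in>I. a i \<le> 2 powr (- (1 / \<epsilon>)) * card A")
    case True
    let ?G = "\<lambda>i. real (core_size \<epsilon> (fiber p A i))"
    have G: "0 < ?G i" if "i \<in> I" for i using core_size_pos[OF fin ne[OF that]] by simp
    have "0 < sum ?G I" using finI neI G by (intro sum_pos) auto
    moreover have "sum ?G I \<le> F"
    proof -
      have "(\<Sum>i\<in>I. core_size \<epsilon> (fiber p A i)) \<le> core_size \<epsilon> A"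
        unfolding I_def using A(1) p \<epsilon>(1)
      proof (rule core_size_ge_sum_fibers)
        fix i assume "i \<in> multiplicity p ` A"
        then show "real (card (fiber p A i)) \<le> 2 powr (- (1 / \<epsilon>)) * card A"
          using bspec[OF True, of i] by (simp add: I_def a_def)
      qed
      then show ?thesis unfolding F_def by (simp flip: of_nat_sum)
    qed
    ultimately have "F powr (- \<delta>) \<le> sum ?G I powr (- \<delta>)"
      using \<epsilon> by (intro powr_mono2') (auto simp: \<delta>_def)
    then have "potential \<epsilon> A \<le> sum a I powr (1 + \<delta>) * sum ?G I powr (- \<delta>)"
      unfolding pot by (intro mult_left_mono) auto
    also have "\<dots> \<le> sum f I"
      unfolding f using finI neI apos G \<epsilon> by (intro sum_powr_div_powr_ge) (auto simp: \<delta>_def)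
    finally have 1: "potential \<epsilon> A \<le> sum f I" .
    have "f i \<le> sqrt (f i1) * sqrt (f i)" if "i \<in> I" for i
    proof -
      have "sqrt (f i) * sqrt (f i) \<le> sqrt (f i1) * sqrt (f i)"
        using M[OF that] by (intro mult_right_mono) (auto simp: f0)
      then show ?thesis using f0 by simp
    qed
    then have "sum f I \<le> sqrt (f i1) * (\<Sum>i\<in>I. sqrt (f i))"
      unfolding sum_distrib_left by (rule sum_mono)
    moreover have "f i1 \<le> sum f I" using finI i1 f0 by (intro member_le_sum) auto
    ultimately show ?thesis using 1 by simp
  next
    case False
    then obtain i2 where i2: "i2 \<in> I" "2 powr (- (1 / \<epsilon>)) * card A < a i2" by force
    have "Max (a ` I) \<in> a ` I" using finI neI by (intro Max_in) auto
    then obtain i0 where i0: "i0 \<in> I" "a i0 = Max (a ` I)" by auto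
    have amax: "a i \<le> a i0" if "i \<in> I" for i using that finI by (simp add: i0)
    define r where "r i = a i / a i0" for i
    define \<psi> where "\<psi> i = a i powr (1 + \<delta>) * F powr (- \<delta>)" for i
    have sumr: "sum r I = card A / a i0" by (simp add: r_def suma flip: sum_divide_distrib)
    have "sum r I \<le> 2 powr (1 / \<epsilon>)"
    proof -
      have "card A < a i2 * 2 powr (1 / \<epsilon>)" using i2(2) by (simp add: powr_minus field_simps)
      also have "\<dots> \<le> a i0 * 2 powr (1 / \<epsilon>)" using amax[OF i2(1)] by (rule mult_right_mono) simp
      finally show ?thesis using apos[OF i0(1)] by (simp add: sumr field_simps)
    qed
    moreover have "0 \<le> sum r I" using apos[OF i0(1)] by (simp add: sumr)
    ultimately have "sum r I powr \<delta> \<le> (2 powr (1 / \<epsilon>)) powr \<delta>"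
      using \<epsilon> by (intro powr_mono2) (auto simp: \<delta>_def)
    also have "\<dots> = sqrt 2" using \<epsilon> by (simp add: powr_powr \<delta>_def powr_half_sqrt)
    finally have "sum r I powr (1 + \<delta>) \<le>
        1/2 * ((\<Sum>i\<in>I. r i powr ((1 + \<delta>) / 2)) + 2 * (\<Sum>i\<in>I. r i powr (1 + \<delta>)) - 1)"
      using finI i0(1) apos amax \<epsilon> by (intro powr_sum_le_mixed_sum[of I i0]) (auto simp: r_def \<delta>_def less_imp_neq[symmetric])
    then have "\<psi> i0 * sum r I powr (1 + \<delta>) \<le>
        \<psi> i0 * (1/2 * ((\<Sum>i\<in>I. r i powr ((1 + \<delta>) / 2)) + 2 * (\<Sum>i\<in>I. r i powr (1 + \<delta>)) - 1))"
      by (intro mult_left_mono) (auto simp: \<psi>_def)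
    also have "\<psi> i0 * sum r I powr (1 + \<delta>) = potential \<epsilon> A"
      using apos[OF i0(1)] by (simp add: sumr pot suma \<psi>_def powr_divide less_imp_le)
    finally have "potential \<epsilon> A \<le>
        1/2 * (\<psi> i0 * (\<Sum>i\<in>I. r i powr ((1 + \<delta>) / 2)) + 2 * (\<psi> i0 * (\<Sum>i\<in>I. r i powr (1 + \<delta>))) - \<psi> i0)"
      by (simp add: algebra_simps)
    also have "\<psi> i0 * (\<Sum>i\<in>I. r i powr (1 + \<delta>)) = sum \<psi> I"
      unfolding sum_distrib_left using apos[OF i0(1)] apos
      by (intro sum.cong) (auto simp: \<psi>_def r_def powr_divide less_imp_le)
    also have "\<psi> i0 * (\<Sum>i\<in>I. r i powr ((1 + \<delta>) / 2)) = sqrt (\<psi> i0) * (\<Sum>i\<in>I. sqrt (\<psi> i))"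
    proof -
      have half: "sqrt (x powr (1 + \<delta>)) = x powr ((1 + \<delta>) / 2)" if "0 < x" for x
        using that by (simp add: powr_powr flip: powr_half_sqrt)
      have "\<psi> i0 * r i powr ((1 + \<delta>) / 2) = sqrt (\<psi> i0) * sqrt (\<psi> i)" if "i \<in> I" for i
      proof -
        have "r i powr ((1 + \<delta>) / 2) = sqrt (\<psi> i) / sqrt (\<psi> i0)"
          using apos[OF i0(1)] apos[OF that] Fpos
          by (simp add: r_def powr_divide \<psi>_def real_sqrt_mult half less_imp_le)
        moreover have "0 < \<psi> i0" using apos[OF i0(1)] Fpos by (simp add: \<psi>_def)
        then have "\<psi> i0 / sqrt (\<psi> i0) = sqrt (\<psi> i0)" by (simp add: real_div_sqrt)
        ultimately show ?thesis by (metis times_divide_eq_left times_divide_eq_right)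
      qed
      then show ?thesis unfolding sum_distrib_left by (rule sum.cong[OF refl])
    qed
    finally have pot_le: "potential \<epsilon> A \<le>
        1/2 * (sqrt (\<psi> i0) * (\<Sum>i\<in>I. sqrt (\<psi> i)) + 2 * sum \<psi> I - \<psi> i0)" .
    have \<psi>0: "0 \<le> \<psi> i" for i by (simp add: \<psi>_def)
    have \<psi>f: "\<psi> i \<le> f i" if "i \<in> I" for i
    proof -
      have "core_size \<epsilon> (fiber p A i) \<le> core_size \<epsilon> A"
        using A(1) fiber_subset ne[OF that] \<epsilon>(1) by (rule core_size_mono)
      then show ?thesis
        unfolding \<psi>_def f F_def using core_size_pos[OF fin ne[OF that]] \<epsilon>
        by (intro mult_left_mono powr_mono2') (auto simp: \<delta>_def)
    qed
    have \<psi>max: "\<psi> i \<le> \<psi> i0" if "i \<in> I" for i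
      unfolding \<psi>_def using amax[OF that] apos[OF that] \<epsilon>
      by (intro mult_right_mono powr_mono2) (auto simp: \<delta>_def)
    \<comment> \<open>The largest lower bound and the largest potential may belong to different fibers.\<close>
    have "sum \<psi> I - \<psi> i0 \<le> sum \<psi> I - \<psi> i1" using \<psi>max[OF i1] by simp
    also have "\<dots> = sum \<psi> (I - {i1})" using finI i1 by (simp add: sum.remove)
    also have "\<dots> \<le> sum f (I - {i1})" using \<psi>f by (intro sum_mono) auto
    also have "\<dots> = sum f I - f i1" using finI i1 by (simp add: sum.remove)
    finally have "sum \<psi> I - \<psi> i0 \<le> sum f I - f i1" .
    moreover have "sum \<psi> I \<le> sum f I" using \<psi>f by (rule sum_mono)
    moreover have "sqrt (\<psi> i0) * (\<Sum>i\<in>I. sqrt (\<psi> i)) \<le> sqrt (f i1) * (\<Sum>i\<in>I. sqrt (f i))"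
      using \<psi>f i0(1) M \<psi>0 by (intro mult_mono sum_mono sum_nonneg) (auto intro: order_trans f0)
    moreover have "x \<le> 1/2 * (y' + 2 * z' - w')"
      if "z - w \<le> z' - w'" "z \<le> z'" "y \<le> y'" "x \<le> 1/2 * (y + 2 * z - w)"
      for x y z w y' z' w' :: real
      using that by argo
    ultimately show ?thesis using pot_le by blast
  qed
qed

lemma card_set_times_ge:
  fixes A B :: "int set"
  assumes "finite A" "finite B" "a \<in> A" "a \<noteq> 0"
  shows "card B \<le> card (A * B)"
proof -
  have "card B = card ((\<lambda>b. a * b) ` B)"
    using assms by (intro card_image[symmetric] inj_onI) simp
  also have "\<dots> \<le> card (A * B)" using assms by (intro card_mono finite_set_times) auto
  finally show ?thesis .
qed

lemma card_fiber_less: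
  assumes "finite A" "x \<in> A" "y \<in> A" "multiplicity p x \<noteq> multiplicity p y"
  shows "card (fiber p A i) < card A"
proof -
  have "x \<notin> fiber p A i \<or> y \<notin> fiber p A i" using assms(4) by (auto simp: fiber_def)
  then have "fiber p A i \<subset> A" using assms(2,3) fiber_subset by blast
  then show ?thesis using assms(1) by (rule psubset_card_mono[rotated])
qed

lemma potential_eq_card:
  assumes "finite A" "query_depth_le 0 A"
  shows "potential \<epsilon> A = card A"
proof (cases "A = {}")
  case False
  have "card A \<le> core_size \<epsilon> A" using core_size_ge[OF assms(1) order.refl assms(2)] by simp
  then have "core_size \<epsilon> A = card A" using core_size_le_card[OF assms(1), of \<epsilon>] by simp
  then show ?thesis unfolding potential_def using False assms(1) by (simp flip: powr_add)
qed (simp add: potential_def)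

lemma potential_pos:
  assumes "finite A" "A \<noteq> {}"
  shows "0 < potential \<epsilon> A"
  using core_size_pos[OF assms] assms by (simp add: potential_def card_gt_0_iff)

text \<open>
  The asymmetric version with two sets is needed for the induction, because the fiber of $AB$ over $s$
  contains all products of fibers over $i$ and $j$ with $i + j = s$.  If no valuation separates
  elements of $A$ or of $B$, both sets have query depth zero and the potential is the cardinality.
\<close>

lemma sqrt_potential_le_card_set_times:
  fixes A B :: "int set"
  assumes "finite A" "finite B" "A \<noteq> {}" "B \<noteq> {}" "0 \<notin> A" "0 \<notin> B" "0 < \<epsilon>" "\<epsilon> \<le> 1/4"
  shows "sqrt (potential \<epsilon> A * potential \<epsilon> B) \<le> card (A * B)"
  using assms
proof (induction "card A + card B" arbitrary: A B rule: less_induct)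
  case less
  note finA = less.prems(1) and finB = less.prems(2) and neA = less.prems(3) and neB = less.prems(4)
    and A0 = less.prems(5) and B0 = less.prems(6) and \<epsilon> = less.prems(7,8)
  show ?case
  proof (cases "\<exists>p. prime p \<and> ((\<exists>x\<in>A. \<exists>y\<in>A. multiplicity p x \<noteq> multiplicity p y) \<or>
                                (\<exists>x\<in>B. \<exists>y\<in>B. multiplicity p x \<noteq> multiplicity p y))")
    case False
    have const: "multiplicity p x = multiplicity p y"
      if "prime p" "x \<in> A \<and> y \<in> A \<or> x \<in> B \<and> y \<in> B" for p x y
      using False that by blast
    have depth0: "query_depth_le 0 C" if C: "C = A \<or> C = B" for C
      unfolding query_depth_le.simps
    proof (intro ballI)
      fix x y assume xy: "x \<in> C" "y \<in> C"
      then have "x \<noteq> 0" "y \<noteq> 0" using C A0 B0 by metis+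
      moreover have "multiplicity p x = multiplicity p y" if "prime p" for p
        using C xy that by (intro const) auto
      ultimately have "normalize x = normalize y" by (rule multiplicity_eq_imp_eq)
      then show "\<bar>x\<bar> = \<bar>y\<bar>" by simp
    qed
    have "potential \<epsilon> A = card A" "potential \<epsilon> B = card B"
      using potential_eq_card[OF finA depth0] potential_eq_card[OF finB depth0] by blast+
    moreover obtain a b where ab: "a \<in> A" "a \<noteq> 0" "b \<in> B" "b \<noteq> 0"
      using neA neB A0 B0 by (metis equals0I)
    have "card B \<le> card (A * B)" "card A \<le> card (A * B)"
      using card_set_times_ge[OF finA finB ab(1,2)] card_set_times_ge[OF finB finA ab(3,4)]
      by (simp_all add: mult.commute)
    then have "real (card A) * card B \<le> real (card (A * B)) * card (A * B)"
      by (intro mult_mono) auto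
    ultimately show ?thesis by (intro real_le_lsqrt) (auto simp: power2_eq_square)
  next
    case True
    then obtain p where p: "prime p" and split:
      "(\<exists>x\<in>A. \<exists>y\<in>A. multiplicity p x \<noteq> multiplicity p y) \<or>
       (\<exists>x\<in>B. \<exists>y\<in>B. multiplicity p x \<noteq> multiplicity p y)" by blast
    define I J where "I = multiplicity p ` A" and "J = multiplicity p ` B"
    define f g where "f = (\<lambda>i. potential \<epsilon> (fiber p A i))" and "g = (\<lambda>j. potential \<epsilon> (fiber p B j))"
    define c where "c s = real (card (fiber p (A * B) s))" for s
    have finI: "finite I" "I \<noteq> {}" and finJ: "finite J" "J \<noteq> {}"
      using finA finB neA neB by (auto simp: I_def J_def)
    have finAB: "finite (A * B)" using finA finB by (rule finite_set_times)
    have finfib: "finite (fiber p A i)" "finite (fiber p B i)" for i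
      using fiber_subset finA finB by (auto intro: finite_subset[OF fiber_subset])
    have nefib: "i \<in> I \<Longrightarrow> fiber p A i \<noteq> {}" "j \<in> J \<Longrightarrow> fiber p B j \<noteq> {}" for i j
      by (auto simp: I_def J_def fiber_def)
    have mult_add: "multiplicity p (a * b) = multiplicity p a + multiplicity p b" if "a \<in> A" "b \<in> B" for a b
      using p A0 B0 that by (intro prime_elem_multiplicity_mult_distrib) auto
    have card_AB: "card (A * B) = sum c (I + J)"
    proof -
      have "multiplicity p ` (A * B) \<subseteq> I + J"
        using mult_add by (auto simp: I_def J_def set_times_def set_plus_def)
      then show ?thesis
        using sum_card_fibers[OF finAB finite_set_plus[OF finI(1) finJ(1)], of p]
        by (simp add: c_def flip: of_nat_sum)
    qed
    have c_ge: "sqrt (f i * g j) \<le> c (i + j)" if i: "i \<in> I" and j: "j \<in> J" for i j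
    proof -
      have "card (fiber p A i) \<le> card A" "card (fiber p B j) \<le> card B"
        using finA finB by (simp_all add: card_mono fiber_subset)
      moreover have "card (fiber p A i) < card A \<or> card (fiber p B j) < card B"
        using split card_fiber_less[OF finA] card_fiber_less[OF finB] by blast
      ultimately have "card (fiber p A i) + card (fiber p B j) < card A + card B" by linarith
      moreover have "0 \<notin> fiber p A i" "0 \<notin> fiber p B j" using A0 B0 by (simp_all add: fiber_def)
      ultimately have "sqrt (f i * g j) \<le> card (fiber p A i * fiber p B j)"
        unfolding f_def g_def using finfib nefib(1)[OF i] nefib(2)[OF j] \<epsilon> by (intro less.hyps)
      also have "fiber p A i * fiber p B j \<subseteq> fiber p (A * B) (i + j)"
        using mult_add by (auto simp: fiber_def set_times_def)
      then have "card (fiber p A i * fiber p B j) \<le> card (fiber p (A * B) (i + j))"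
        using finite_subset[OF fiber_subset finAB] by (intro card_mono)
      finally show ?thesis by (simp add: c_def)
    qed
    have fpos: "0 < f i" if "i \<in> I" for i using potential_pos[OF finfib(1) nefib(1)[OF that]] by (simp add: f_def)
    have gpos: "0 < g j" if "j \<in> J" for j using potential_pos[OF finfib(2) nefib(2)[OF that]] by (simp add: g_def)
    have "Max (f ` I) \<in> f ` I" "Max (g ` J) \<in> g ` J" using finI finJ by (auto intro!: Max_in)
    then obtain i1 j1 where i1: "i1 \<in> I" "f i1 = Max (f ` I)" and j1: "j1 \<in> J" "g j1 = Max (g ` J)" by auto
    have fmax: "f i \<le> f i1" if "i \<in> I" for i using that finI by (simp add: i1)
    have gmax: "g j \<le> g j1" if "j \<in> J" for j using that finJ by (simp add: j1)
    define D where "D = sqrt (f i1 * g j1)"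
    define N where "N = real (card (A * B))"
    have D: "0 < D" using fpos[OF i1(1)] gpos[OF j1(1)] by (simp add: D_def)
    define a b where "a = 1/2 * ((\<Sum>i\<in>I. sqrt (f i)) / sqrt (f i1) + 2 * (sum f I / f i1) - 1)"
      and "b = 1/2 * ((\<Sum>j\<in>J. sqrt (g j)) / sqrt (g j1) + 2 * (sum g J / g j1) - 1)"
    \<comment> \<open>The layer-cake bound for the number of products.\<close>
    have diag: "sum f I / f i1 + sum g J / g j1 - 1 \<le> N / D"
    proof -
      have "(\<Sum>i\<in>I. f i / f i1) + (\<Sum>j\<in>J. g j / g j1) - 1 \<le> (\<Sum>s\<in>I + J. c s / D)"
      proof (rule sum_over_sumset_ge)
        fix i j assume i: "i \<in> I" and j: "j \<in> J"
        let ?x = "f i / f i1" and ?y = "g j / g j1"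
        have xy: "0 < ?x" "0 < ?y" using fpos[OF i] fpos[OF i1(1)] gpos[OF j] gpos[OF j1(1)] by simp_all
        have "min ?x ?y * min ?x ?y \<le> ?x * ?y" using xy by (intro mult_mono) auto
        then have "min ?x ?y \<le> sqrt (?x * ?y)" by (intro real_le_rsqrt) (simp add: power2_eq_square)
        also have "\<dots> = sqrt (f i * g j) / D" by (simp add: D_def real_sqrt_mult real_sqrt_divide)
        also have "\<dots> \<le> c (i + j) / D" using c_ge[OF i j] D by (intro divide_right_mono) auto
        finally show "min ?x ?y \<le> c (i + j) / D" .
      qed (use finI finJ i1(1) j1(1) fpos gpos fmax gmax in \<open>auto simp: less_imp_le less_imp_neq[symmetric]\<close>)
      then show ?thesis by (simp add: N_def card_AB flip: sum_divide_distrib)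
    qed
    \<comment> \<open>The products of the fiber of \<open>A\<close> with largest potential and all fibers of \<open>B\<close>.\<close>
    have row: "(\<Sum>j\<in>J. sqrt (g j)) / sqrt (g j1) \<le> N / D"
    proof -
      have "(\<Sum>j\<in>J. sqrt (f i1) * sqrt (g j)) \<le> (\<Sum>j\<in>J. c (i1 + j))"
        using c_ge[OF i1(1)] by (intro sum_mono) (simp add: real_sqrt_mult)
      also have "\<dots> = sum c ((\<lambda>j. i1 + j) ` J)" by (simp add: sum.reindex)
      also have "\<dots> \<le> sum c (I + J)"
        using i1(1) finI finJ by (intro sum_mono2 finite_set_plus) (auto simp: c_def)
      finally show ?thesis using fpos[OF i1(1)] gpos[OF j1(1)]
        by (simp add: N_def card_AB D_def real_sqrt_mult field_simps flip: sum_distrib_left)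
    qed
    have column: "(\<Sum>i\<in>I. sqrt (f i)) / sqrt (f i1) \<le> N / D"
    proof -
      have "(\<Sum>i\<in>I. sqrt (f i) * sqrt (g j1)) \<le> (\<Sum>i\<in>I. c (i + j1))"
        using c_ge[OF _ j1(1)] by (intro sum_mono) (simp add: real_sqrt_mult)
      also have "\<dots> = sum c ((\<lambda>i. i + j1) ` I)" by (simp add: sum.reindex)
      also have "\<dots> \<le> sum c (I + J)"
        using j1(1) finI finJ by (intro sum_mono2 finite_set_plus) (auto simp: c_def)
      finally show ?thesis using fpos[OF i1(1)] gpos[OF j1(1)]
        by (simp add: N_def card_AB D_def real_sqrt_mult field_simps flip: sum_distrib_right)
    qed
    have pot_A: "potential \<epsilon> A \<le> f i1 * a"
    proof -
      have "potential \<epsilon> A \<le> 1/2 * (sqrt (f i1) * (\<Sum>i\<in>I. sqrt (f i)) + 2 * sum f I - f i1)"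
        using finA neA p \<epsilon> I_def f_def i1(1) fmax by (rule potential_le_fibers)
      also have "\<dots> = f i1 * a" using fpos[OF i1(1)] by (simp add: a_def field_simps)
      finally show ?thesis .
    qed
    have pot_B: "potential \<epsilon> B \<le> g j1 * b"
    proof -
      have "potential \<epsilon> B \<le> 1/2 * (sqrt (g j1) * (\<Sum>j\<in>J. sqrt (g j)) + 2 * sum g J - g j1)"
        using finB neB p \<epsilon> J_def g_def j1(1) gmax by (rule potential_le_fibers)
      also have "\<dots> = g j1 * b" using gpos[OF j1(1)] by (simp add: b_def field_simps)
      finally show ?thesis .
    qed
    have pos: "0 < f i1 * a" "0 < g j1 * b"
      using pot_A pot_B potential_pos[OF finA neA, of \<epsilon>] potential_pos[OF finB neB, of \<epsilon>] by linarith+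
    then have ab: "0 < a" "0 < b" using fpos[OF i1(1)] gpos[OF j1(1)] by (simp_all add: zero_less_mult_iff)
    have "sqrt (potential \<epsilon> A * potential \<epsilon> B) \<le> sqrt ((f i1 * a) * (g j1 * b))"
      using pot_A pot_B pos potential_pos[OF finB neB, of \<epsilon>]
      by (intro real_sqrt_le_mono mult_mono) auto
    also have "\<dots> = D * sqrt (a * b)" by (simp add: D_def real_sqrt_mult)
    also have "\<dots> \<le> D * ((a + b) / 2)"
      using ab D by (intro mult_left_mono arith_geo_mean_sqrt) auto
    also have "(a + b) / 2 \<le> N / D"
      unfolding a_def b_def using diag row column by argo
    then have "D * ((a + b) / 2) \<le> D * (N / D)" using D by (intro mult_left_mono) auto
    also have "\<dots> = N" using D by simp
    finally show ?thesis by (simp add: N_def)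
  qed
qed

lemma exists_large_subset_query_depth_le:
  assumes A: "finite A" "A \<noteq> {}" "0 \<notin> A" and \<epsilon>: "0 < \<epsilon>" "\<epsilon> \<le> 1/4"
    and K: "K = real (card (A * A)) / card A"
  shows "\<exists>B\<subseteq>A. query_depth_le (budget \<epsilon> A) B \<and> card A * K powr (- (2 / \<epsilon>)) \<le> card B"
proof -
  define F where "F = real (core_size \<epsilon> A)"
  have F: "0 < F" using core_size_pos[OF A(1,2)] by (simp add: F_def)
  have n: "0 < real (card A)" using A by (simp add: card_gt_0_iff)
  have "potential \<epsilon> A \<le> card (A * A)"
    using sqrt_potential_le_card_set_times[of A A \<epsilon>] A \<epsilon> potential_pos[OF A(1,2), of \<epsilon>] by simp
  also have "potential \<epsilon> A = card A * (card A / F) powr (\<epsilon> / 2)"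
    unfolding potential_def powr_add F_def[symmetric]
    using n F by (simp add: powr_minus powr_divide field_simps)
  finally have "(card A / F) powr (\<epsilon> / 2) \<le> K" using n by (simp add: K field_simps)
  then have "((card A / F) powr (\<epsilon> / 2)) powr (2 / \<epsilon>) \<le> K powr (2 / \<epsilon>)"
    using \<epsilon> by (intro powr_mono2) auto
  then have "card A / F \<le> K powr (2 / \<epsilon>)" using n F \<epsilon> by (simp add: powr_powr)
  moreover obtain a where "a \<in> A" "a \<noteq> 0" using A(2,3) by (metis equals0I)
  then have "0 < K powr (2 / \<epsilon>)"
    using n card_set_times_ge[OF A(1,1), of a] by (simp add: K)
  ultimately have "card A * K powr (- (2 / \<epsilon>)) \<le> F" using F by (simp add: powr_minus field_simps)
  then show ?thesis using core_size_attained[OF A(1), of \<epsilon>] by (auto simp: F_def)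
qed

section \<open>Inequalities for moments\<close>

text \<open>
  Removing the linear term of $(1+x)^{2k}$ leaves a function that is quadratic at zero, so it is
  bounded by $(1+Cx^2)^k$ for some $C$; the point is the size $C = k^2$.  Except for small $k$, where
  the polynomials are compared directly, $(1+x)^{2k} \le (1+k^2x^2)^k$ holds unless
  $2kx \le 1$, and in that range the quadratic Taylor bound of the exponential function is enough.
\<close>

lemma one_plus_power_le:
  fixes x :: real
  assumes "0 \<le> x" "1 \<le> k"
  shows "(1 + x) ^ (2 * k) \<le> 2 * real k * x + (1 + (real k)\<^sup>2 * x\<^sup>2) ^ k"
proof (cases "2 * x + x\<^sup>2 \<le> (real k)\<^sup>2 * x\<^sup>2")
  case True
  have "(1 + x) ^ (2 * k) = ((1 + x)\<^sup>2) ^ k" by (rule power_mult)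
  also have "(1 + x)\<^sup>2 = 1 + (2 * x + x\<^sup>2)" by (simp add: power2_eq_square algebra_simps)
  also have "(1 + (2 * x + x\<^sup>2)) ^ k \<le> (1 + (real k)\<^sup>2 * x\<^sup>2) ^ k" using True assms by (intro power_mono) auto
  also have "\<dots> \<le> 2 * real k * x + (1 + (real k)\<^sup>2 * x\<^sup>2) ^ k" using assms by simp
  finally show ?thesis .
next
  case False
  consider "k = 1" | "k = 2" | "k = 3" | "k = 4" | "5 \<le> k" using assms by linarith
  then show ?thesis
  proof cases
    case 1
    then show ?thesis by (simp add: power2_eq_square algebra_simps)
  next
    case 2
    have "0 \<le> x\<^sup>2 * (2 * (1 - x)\<^sup>2 + 13 * x\<^sup>2)" by simp
    then show ?thesis using 2 by (simp add: power2_eq_square eval_nat_numeral algebra_simps)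
  next
    case 3
    have "0 \<le> x\<^sup>2 * (12 * (1 - x)\<^sup>2 + 4 * x + x\<^sup>2 * (213 + 3 * (1 - x)\<^sup>2) + 725 * x^4)"
      using assms by simp
    then show ?thesis using 3 by (simp add: power2_eq_square eval_nat_numeral algebra_simps)
  next
    case 4
    have "0 \<le> x\<^sup>2 * (8 + 28 * (1 - x)\<^sup>2 + x\<^sup>2 * (1410 + 28 * (1 - x)\<^sup>2)
        + x^4 * (16324 + 4 * (1 - x)\<^sup>2) + 65531 * x^6)"
      using assms by simp
    then show ?thesis using 4 assms
      by (simp add: power2_eq_square eval_nat_numeral algebra_simps)
  next
    case 5
    have "x * ((real k)\<^sup>2 - 1) < 2"
    proof -
      have "x * (x * ((real k)\<^sup>2 - 1)) < x * 2" using False by (simp add: power2_eq_square algebra_simps)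
      then show ?thesis using assms by (simp add: mult_less_cancel_left)
    qed
    moreover have "x * (4 * k) \<le> x * ((real k)\<^sup>2 - 1)"
    proof (intro mult_left_mono)
      have "5 * real k \<le> real k * real k" using 5 by (intro mult_right_mono) auto
      then show "real (4 * k) \<le> (real k)\<^sup>2 - 1"
        using 5 unfolding power2_eq_square of_nat_mult of_nat_numeral by linarith
    qed (use assms in auto)
    ultimately have small: "2 * real k * x \<le> 1" by (simp add: mult.commute)
    have "(1 + x) ^ (2 * k) \<le> exp x ^ (2 * k)"
      using assms exp_ge_add_one_self[of x] by (intro power_mono) auto
    also have "\<dots> = exp (2 * real k * x)" by (simp add: exp_of_nat_mult[symmetric])
    also have "\<dots> \<le> 1 + 2 * real k * x + (2 * real k * x)\<^sup>2" using assms small by (intro exp_bound) auto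
    also have "(2 * real k * x)\<^sup>2 \<le> k * ((real k)\<^sup>2 * x\<^sup>2)"
      using mult_right_mono[of 4 "real k" "(real k)\<^sup>2 * x\<^sup>2"] 5 by (simp add: power_mult_distrib)
    also have "1 + 2 * real k * x + k * ((real k)\<^sup>2 * x\<^sup>2) \<le> 2 * real k * x + (1 + (real k)\<^sup>2 * x\<^sup>2) ^ k"
    proof -
      have "1 + k * ((real k)\<^sup>2 * x\<^sup>2) \<le> (1 + (real k)\<^sup>2 * x\<^sup>2) ^ k"
        by (rule Bernoulli_inequality) (rule order_trans[of _ 0], auto)
      then show ?thesis by simp
    qed
    finally show ?thesis by simp
  qed
qed

lemma power_ge_tangent:
  fixes a b :: real
  assumes "0 \<le> b" "b \<le> a"
  shows "k * b ^ (k - 1) * (a - b) \<le> a ^ k - b ^ k"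
proof (induction k)
  case (Suc k)
  have "k * b ^ k * (a - b) \<le> a * (k * b ^ (k - 1) * (a - b))"
  proof (cases k)
    case (Suc j)
    have "b * (k * b ^ (k - 1) * (a - b)) \<le> a * (k * b ^ (k - 1) * (a - b))"
      using assms by (intro mult_right_mono) auto
    then show ?thesis by (simp add: Suc algebra_simps)
  qed simp
  also have "\<dots> \<le> a * (a ^ k - b ^ k)" using Suc assms by (intro mult_left_mono) auto
  finally show ?case by (simp add: algebra_simps)
qed simp

text \<open>
  Lower bounds for twice the even and twice the odd part of $(S+y)^k$; the induction step for either
  of them uses the other.
\<close>

lemma power_add_sub_bounds:
  fixes S y :: real
  assumes "0 \<le> y" "y \<le> S"
  shows "2 * S ^ k \<le> (S + y) ^ k + (S - y) ^ k \<and> 2 * k * S ^ (k - 1) * y \<le> (S + y) ^ k - (S - y) ^ k"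
proof (induction k)
  case (Suc k)
  let ?P = "(S + y) ^ k + (S - y) ^ k" and ?M = "(S + y) ^ k - (S - y) ^ k"
  have M0: "0 \<le> ?M" using assms by (simp add: power_mono)
  have "2 * S ^ Suc k \<le> S * ?P" using Suc assms mult_left_mono[of "2 * S ^ k" ?P S] by (simp add: algebra_simps)
  also have "\<dots> \<le> S * ?P + y * ?M" using M0 assms by simp
  also have "\<dots> = (S + y) ^ Suc k + (S - y) ^ Suc k" by (simp add: algebra_simps)
  finally have 1: "2 * S ^ Suc k \<le> (S + y) ^ Suc k + (S - y) ^ Suc k" .
  have "2 * k * S ^ k * y = S * (2 * k * S ^ (k - 1) * y)" by (cases k) auto
  also have "\<dots> \<le> S * ?M" using Suc assms by (intro mult_left_mono) auto
  finally have "2 * k * S ^ k * y + y * (2 * S ^ k) \<le> S * ?M + y * ?P"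
    using Suc assms by (intro add_mono mult_left_mono) auto
  also have "\<dots> = (S + y) ^ Suc k - (S - y) ^ Suc k" by (simp add: algebra_simps)
  finally have "2 * real (Suc k) * S ^ k * y \<le> (S + y) ^ Suc k - (S - y) ^ Suc k"
    by (simp add: algebra_simps)
  with 1 show ?case by simp
qed simp

text \<open>
  The inequality \<open>one_plus_power_le\<close> for vectors: with $s = |h|$, $t = |g|$ and $y = 2 \mathrm{Re}(\bar h g)$, the left-hand
  side is $|h+g|^{2k}$ and the last term is its first-order variation in $g$.  By convexity in
  $y$ the extreme case is that of parallel $h$ and $g$, $y = 2st$.
\<close>

lemma power_le_first_order:
  fixes s t y :: real
  assumes "0 \<le> s" "0 \<le> t" "\<bar>y\<bar> \<le> 2 * s * t" "1 \<le> k"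
  shows "(s\<^sup>2 + y + t\<^sup>2) ^ k \<le> (s\<^sup>2 + (real k)\<^sup>2 * t\<^sup>2) ^ k + k * (s\<^sup>2) ^ (k - 1) * y"
proof -
  define S where "S = s\<^sup>2 + t\<^sup>2"
  define Y where "Y = 2 * s * t"
  have Y: "0 \<le> Y" "Y \<le> S" using assms sum_squares_bound[of s t] by (simp_all add: Y_def S_def)
  have slope: "k * (s\<^sup>2) ^ (k - 1) \<le> k * b ^ (k - 1)" if "S \<le> b" for b :: real
  proof -
    have "s\<^sup>2 \<le> b" using that zero_le_power2[of t] unfolding S_def by linarith
    then show ?thesis by (intro mult_left_mono power_mono) auto
  qed
  have top: "(S + Y) ^ k \<le> (s\<^sup>2 + (real k)\<^sup>2 * t\<^sup>2) ^ k + k * (s\<^sup>2) ^ (k - 1) * Y"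
  proof (cases "s = 0")
    case True
    have "t\<^sup>2 * 1 \<le> t\<^sup>2 * (real k)\<^sup>2" using assms by (intro mult_left_mono) auto
    then show ?thesis using True by (simp add: S_def Y_def power_mono mult.commute)
  next
    case False
    then have s: "0 < s" using assms by simp
    have "s ^ (2 * k) * (1 + t / s) ^ (2 * k) \<le>
        s ^ (2 * k) * (2 * real k * (t / s) + (1 + (real k)\<^sup>2 * (t / s)\<^sup>2) ^ k)"
      using s assms by (intro mult_left_mono one_plus_power_le) auto
    also have "s ^ (2 * k) * (1 + t / s) ^ (2 * k) = (S + Y) ^ k"
    proof -
      have "s ^ (2 * k) * (1 + t / s) ^ (2 * k) = (s * (1 + t / s)) ^ (2 * k)"
        by (simp only: power_mult_distrib)
      also have "s * (1 + t / s) = s + t" using s by (simp add: field_simps)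
      also have "(s + t) ^ (2 * k) = ((s + t)\<^sup>2) ^ k" by (rule power_mult)
      also have "(s + t)\<^sup>2 = S + Y" by (simp add: S_def Y_def power2_eq_square algebra_simps)
      finally show ?thesis .
    qed
    also have "s ^ (2 * k) * (2 * real k * (t / s) + (1 + (real k)\<^sup>2 * (t / s)\<^sup>2) ^ k) =
        s ^ (2 * k) * (2 * real k * (t / s)) + (s\<^sup>2 * (1 + (real k)\<^sup>2 * (t / s)\<^sup>2)) ^ k"
      unfolding distrib_left[of "s ^ (2 * k)"] power_mult_distrib[of "s\<^sup>2"] by (simp only: power_mult)
    also have "s\<^sup>2 * (1 + (real k)\<^sup>2 * (t / s)\<^sup>2) = s\<^sup>2 + (real k)\<^sup>2 * t\<^sup>2"
      using s by (simp add: power_divide field_simps)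
    also have "s ^ (2 * k) * (2 * real k * (t / s)) = k * (s\<^sup>2) ^ (k - 1) * Y"
    proof -
      have "s ^ (2 * k) = (s\<^sup>2) ^ (k - 1) * (s * s)"
        using assms by (cases k) (auto simp: power_mult power2_eq_square)
      then show ?thesis using s by (simp add: Y_def)
    qed
    finally show ?thesis by simp
  qed
  have nonneg: "(S + y) ^ k \<le> (s\<^sup>2 + (real k)\<^sup>2 * t\<^sup>2) ^ k + k * (s\<^sup>2) ^ (k - 1) * y"
    if "0 \<le> y" "y \<le> Y" for y
  proof -
    have "k * (s\<^sup>2) ^ (k - 1) * (Y - y) \<le> k * (S + y) ^ (k - 1) * (Y - y)"
      using that by (intro mult_right_mono slope) auto
    also have "\<dots> \<le> (S + Y) ^ k - (S + y) ^ k"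
      using power_ge_tangent[of "S + y" "S + Y" k] that Y by simp
    finally show ?thesis using top by (simp add: algebra_simps)
  qed
  show ?thesis
  proof (cases "0 \<le> y")
    case True
    then show ?thesis using nonneg[of y] assms by (simp add: S_def Y_def algebra_simps)
  next
    case False
    define z where "z = - y"
    have z: "0 \<le> z" "z \<le> Y" using False assms by (simp_all add: z_def Y_def)
    have "k * (s\<^sup>2) ^ (k - 1) * (2 * z) \<le> k * S ^ (k - 1) * (2 * z)"
      using z by (intro mult_right_mono slope) auto
    also have "\<dots> \<le> (S + z) ^ k - (S - z) ^ k"
      using power_add_sub_bounds[of z S k] z Y by (simp add: algebra_simps)
    finally have "(S - z) ^ k \<le> (s\<^sup>2 + (real k)\<^sup>2 * t\<^sup>2) ^ k - k * (s\<^sup>2) ^ (k - 1) * z"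
      using nonneg[OF z] by (simp add: algebra_simps)
    then show ?thesis by (simp add: S_def z_def algebra_simps)
  qed
qed

lemma convex_power_atLeast: "convex_on {0::real..} (\<lambda>x. x ^ k)"
proof (cases "even k")
  case True
  then show ?thesis by (intro convex_on_subset[OF convex_power_even]) auto
next
  case False
  then show ?thesis by (rule convex_power_odd)
qed

text \<open>
  Minkowski's inequality in $L^k$, with upper bounds in place of the norms.
\<close>

lemma sum_power_add_le:
  fixes u v :: "'a \<Rightarrow> real"
  assumes "finite X" and u: "\<And>x. x \<in> X \<Longrightarrow> 0 \<le> u x" and v: "\<And>x. x \<in> X \<Longrightarrow> 0 \<le> v x"
    and "0 < a" "0 < b"
    and "(\<Sum>x\<in>X. u x ^ k) \<le> N * a ^ k" "(\<Sum>x\<in>X. v x ^ k) \<le> N * b ^ k"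
  shows "(\<Sum>x\<in>X. (u x + v x) ^ k) \<le> N * (a + b) ^ k"
proof -
  define l where "l = a / (a + b)"
  have l: "0 < l" "l < 1" "1 - l = b / (a + b)" using assms by (simp_all add: l_def field_simps)
  have "(u x + v x) ^ k \<le> l * (u x / l) ^ k + (1 - l) * (v x / (1 - l)) ^ k" if "x \<in> X" for x
  proof -
    have "((1 - l) *\<^sub>R (v x / (1 - l)) + l *\<^sub>R (u x / l)) ^ k \<le> (1 - l) * (v x / (1 - l)) ^ k + l * (u x / l) ^ k"
      using l(1,2) u[OF that] v[OF that] by (intro convex_onD[OF convex_power_atLeast]) auto
    then show ?thesis using l(1,2) by (simp add: add.commute)
  qed
  then have "(\<Sum>x\<in>X. (u x + v x) ^ k) \<le> (\<Sum>x\<in>X. l * (u x / l) ^ k + (1 - l) * (v x / (1 - l)) ^ k)"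
    by (rule sum_mono)
  also have "\<dots> = l / l ^ k * (\<Sum>x\<in>X. u x ^ k) + (1 - l) / (1 - l) ^ k * (\<Sum>x\<in>X. v x ^ k)"
    by (simp add: sum.distrib sum_distrib_left power_divide)
  also have "\<dots> \<le> l / l ^ k * (N * a ^ k) + (1 - l) / (1 - l) ^ k * (N * b ^ k)"
    using l assms by (intro add_mono mult_left_mono) auto
  also have "\<dots> = l * (N * (a / l) ^ k) + (1 - l) * (N * (b / (1 - l)) ^ k)"
    by (simp add: power_divide)
  also have "a / l = a + b" using assms by (simp add: l_def)
  also have "b / (1 - l) = a + b" unfolding l(3) using assms by simp
  also have "l * (N * (a + b) ^ k) + (1 - l) * (N * (a + b) ^ k) = N * (a + b) ^ k"
    by (simp add: algebra_simps)
  finally show ?thesis .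
qed

section \<open>Exponential sums modulo an integer\<close>

text \<open>
  The exponential sums are functions on the residues modulo $N$, so that all moments are finite sums.
  The modulus is chosen at the end, divisible by all elements of the set and larger than all
  differences of sums.
\<close>

definition character :: "nat \<Rightarrow> int \<Rightarrow> nat \<Rightarrow> complex"
  where "character N a x = cis (2 * pi * (a * x / N))"

definition trig_poly :: "nat \<Rightarrow> int set \<Rightarrow> nat \<Rightarrow> complex"
  where "trig_poly N A x = (\<Sum>a\<in>A. character N a x)"

lemma cis_eq_1_iff: "cis (2 * pi * t) = 1 \<longleftrightarrow> t \<in> \<int>"
proof
  assume "cis (2 * pi * t) = 1"
  then have "cos (2 * pi * t) = 1" by (simp add: complex_eq_iff)
  then obtain n :: int where "2 * pi * t = n * 2 * pi" by (auto simp: cos_one_2pi_int)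
  then have "t = n" by simp
  then show "t \<in> \<int>" by simp
qed simp

lemma character_add_left: "character N (a + b) x = character N a x * character N b x"
  by (simp add: character_def cis_mult algebra_simps add_divide_distrib)

lemma character_add_right: "character N a (x + y) = character N a x * character N a y"
  by (simp add: character_def cis_mult algebra_simps add_divide_distrib)

lemma cnj_character: "cnj (character N a x) = character N (- a) x"
  by (simp add: character_def cis_cnj)

lemma character_0 [simp]: "character N a 0 = 1" "character N 0 x = 1"
  by (simp_all add: character_def)

lemma norm_character [simp]: "cmod (character N a x) = 1"
  by (simp add: character_def)

lemma character_eq_1_iff:
  assumes "0 < q" "0 < y"
  shows "character (q * y) a y = 1 \<longleftrightarrow> int q dvd a"
proof -
  have "character (q * y) a y = cis (2 * pi * (real_of_int a / real_of_int (int q)))"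
    using assms by (simp add: character_def)
  also have "\<dots> = 1 \<longleftrightarrow> int q dvd a"
    unfolding cis_eq_1_iff
  proof
    assume "real_of_int a / real_of_int (int q) \<in> \<int>"
    then obtain n :: int where "real_of_int a / real_of_int (int q) = real_of_int n"
      by (auto elim: Ints_cases)
    then have "real_of_int a = real_of_int (n * int q)" using assms by (simp add: field_simps)
    then have "a = n * int q" by (simp only: of_int_eq_iff)
    then show "int q dvd a" by simp
  qed (use assms in \<open>auto elim!: dvdE\<close>)
  finally show ?thesis .
qed

lemma sum_shift_periodic:
  fixes \<phi> :: "nat \<Rightarrow> 'a::ab_group_add"
  assumes "\<And>x. \<phi> (x + N) = \<phi> x"
  shows "(\<Sum>x<N. \<phi> (x + y)) = (\<Sum>x<N. \<phi> x)"
proof (induction y)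
  case (Suc y)
  have "(\<Sum>x<N. \<phi> (x + Suc y)) + \<phi> y = (\<Sum>x<Suc N. \<phi> (x + y))"
    by (subst sum.lessThan_Suc_shift) (simp add: add.commute)
  also have "\<dots> = (\<Sum>x<N. \<phi> (x + y)) + \<phi> y"
    using assms[of y] by (simp add: add.commute)
  finally show ?case using Suc by simp
qed simp

text \<open>
  A translation by $y$ fixes $W$ and multiplies the character by a number different from one, so
  the sum is equal to a nontrivial multiple of itself.
\<close>

lemma sum_periodic_mult_character_eq_0:
  assumes N: "N = q * y" "0 < q" "0 < y"
    and W: "\<And>x. W (x + y) = W x" and "\<not> int q dvd a"
  shows "(\<Sum>x<N. W x * character N a x) = 0"
proof -
  let ?\<phi> = "\<lambda>x. W x * character N a x"
  have W': "W (x + n * y) = W x" for x n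
    by (induction n) (simp_all add: W add.assoc[symmetric] add.commute[of y])
  have "character N a N = 1" using N character_eq_1_iff[of 1 N a] by simp
  then have "?\<phi> (x + N) = ?\<phi> x" for x using W'[of x q] by (simp add: character_add_right N(1))
  then have "sum ?\<phi> {..<N} = (\<Sum>x<N. ?\<phi> (x + y))" by (rule sum_shift_periodic[symmetric])
  also have "\<dots> = sum ?\<phi> {..<N} * character N a y"
    by (simp add: W character_add_right sum_distrib_right mult.assoc)
  finally have "sum ?\<phi> {..<N} * (1 - character N a y) = 0" by (simp add: algebra_simps)
  moreover have "character N a y \<noteq> 1" using assms character_eq_1_iff[of q y a] by simp
  ultimately show ?thesis by simp
qed

lemma sum_character:
  assumes "\<not> int N dvd a" "0 < N"
  shows "(\<Sum>x<N. character N a x) = 0"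
  using sum_periodic_mult_character_eq_0[of N N 1 "\<lambda>_. 1" a] assms by simp

text \<open>
  Parseval's identity.
\<close>

lemma sum_norm_sq_trig_sum:
  fixes r :: "int \<Rightarrow> real"
  assumes "finite S" "0 < N" and inj: "\<And>s t. s \<in> S \<Longrightarrow> t \<in> S \<Longrightarrow> s \<noteq> t \<Longrightarrow> \<not> int N dvd s - t"
  shows "(\<Sum>x<N. (cmod (\<Sum>s\<in>S. r s * character N s x))\<^sup>2) = N * (\<Sum>s\<in>S. (r s)\<^sup>2)"
proof -
  have "complex_of_real ((cmod (\<Sum>s\<in>S. r s * character N s x))\<^sup>2) =
      (\<Sum>s\<in>S. \<Sum>t\<in>S. r s * r t * character N (s - t) x)" for x
  proof -
    have "complex_of_real ((cmod (\<Sum>s\<in>S. r s * character N s x))\<^sup>2) =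
        (\<Sum>s\<in>S. r s * character N s x) * (\<Sum>t\<in>S. r t * character N (- t) x)"
      by (simp only: complex_norm_square cnj_sum complex_cnj_mult complex_cnj_complex_of_real cnj_character)
    also have "\<dots> = (\<Sum>s\<in>S. \<Sum>t\<in>S. r s * r t * (character N s x * character N (- t) x))"
      by (simp add: sum_product mult_ac)
    finally show ?thesis by (simp flip: character_add_left)
  qed
  then have "complex_of_real (\<Sum>x<N. (cmod (\<Sum>s\<in>S. r s * character N s x))\<^sup>2) =
      (\<Sum>x<N. \<Sum>s\<in>S. \<Sum>t\<in>S. r s * r t * character N (s - t) x)"
    by (simp only: of_real_sum)
  also have "\<dots> = (\<Sum>s\<in>S. \<Sum>t\<in>S. \<Sum>x<N. r s * r t * character N (s - t) x)"
    by (subst sum.swap, rule sum.cong[OF refl], rule sum.swap)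
  also have "\<dots> = (\<Sum>s\<in>S. \<Sum>t\<in>S. if s = t then of_real (N * (r s)\<^sup>2) else 0)"
  proof (intro sum.cong refl)
    fix s t assume "s \<in> S" "t \<in> S"
    then show "(\<Sum>x<N. r s * r t * character N (s - t) x) = (if s = t then of_real (N * (r s)\<^sup>2) else 0)"
      using sum_character[OF inj[of s t] \<open>0 < N\<close>]
      by (auto simp: power2_eq_square simp flip: sum_distrib_left)
  qed
  also have "\<dots> = of_real (N * (\<Sum>s\<in>S. (r s)\<^sup>2))"
    using assms(1) by (simp add: sum.delta' sum_distrib_left)
  finally show ?thesis by (simp only: of_real_eq_iff)
qed

lemma finite_sumset: "finite A \<Longrightarrow> finite (sumset k A)"
  unfolding sumset_def by (induction k) (simp_all add: finite_set_plus)

lemma trig_poly_power: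
  assumes "finite A"
  shows "\<exists>r::int \<Rightarrow> real. \<forall>x. trig_poly N A x ^ k = (\<Sum>s\<in>sumset k A. r s * character N s x)"
proof (induction k)
  case 0
  show ?case by (rule exI[of _ "\<lambda>_. 1"]) (simp add: sumset_def)
next
  case (Suc k)
  then obtain r :: "int \<Rightarrow> real"
    where r: "\<And>x. trig_poly N A x ^ k = (\<Sum>s\<in>sumset k A. r s * character N s x)" by blast
  have step: "sumset (Suc k) A = sumset k A + A" by (simp add: sumset_def)
  let ?P = "sumset k A \<times> A"
  define r' where "r' u = (\<Sum>(s, a)\<in>{z \<in> ?P. fst z + snd z = u}. r s)" for u
  have "trig_poly N A x ^ Suc k = (\<Sum>u\<in>sumset (Suc k) A. r' u * character N u x)" for x
  proof -
    have "trig_poly N A x ^ Suc k = (\<Sum>s\<in>sumset k A. r s * character N s x) * (\<Sum>a\<in>A. character N a x)"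
      by (simp only: power_Suc2 r) (simp only: trig_poly_def)
    also have "\<dots> = (\<Sum>z\<in>?P. r (fst z) * character N (fst z + snd z) x)"
      by (simp add: sum_product sum.cartesian_product character_add_left mult.assoc case_prod_unfold)
    also have "\<dots> = (\<Sum>u\<in>sumset (Suc k) A. \<Sum>z\<in>{z \<in> ?P. fst z + snd z = u}. r (fst z) * character N (fst z + snd z) x)"
      using assms by (intro sum.group[symmetric]) (auto simp: step finite_sumset finite_set_plus)
    also have "\<dots> = (\<Sum>u\<in>sumset (Suc k) A. r' u * character N u x)"
      by (intro sum.cong refl) (simp add: r'_def sum_distrib_right case_prod_unfold)
    finally show ?thesis .
  qed
  then show ?case by blast
qed

section \<open>Small query depth forces many sums\<close>

text \<open>
  The statement that the square of the normalised $L^{2k}$ norm of the exponential sum over $A$ is at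
  most $s$; squares of norms are the quantities that add up under decomposition.
\<close>

definition moment_le :: "nat \<Rightarrow> nat \<Rightarrow> int set \<Rightarrow> real \<Rightarrow> bool"
  where "moment_le N k A s \<longleftrightarrow> (\<Sum>x<N. cmod (trig_poly N A x) ^ (2 * k)) \<le> N * s ^ k"

lemma moment_le_mono:
  assumes "moment_le N k A s" "0 \<le> s" "s \<le> s'"
  shows "moment_le N k A s'"
proof -
  have "N * s ^ k \<le> N * s' ^ k" using assms by (intro mult_left_mono power_mono) auto
  then show ?thesis using assms(1) unfolding moment_le_def by linarith
qed

text \<open>
  The martingale step.  Writing $h$ and $g$ for the exponential sums over $H$ and $G$, the function $h$
  has period $y = N/q$.  Hence the first-order term $|h|^{2k-2}\,\mathrm{Re}(\bar h g)$ in the expansion of $|h+g|^{2k}$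
  sums to zero, and what remains is at most $(|h|^2 + k^2|g|^2)^k$ pointwise.
\<close>

lemma moment_le_Un:
  assumes fin: "finite G" "finite H" and "0 < s" "0 < t" "1 \<le> k"
    and q: "0 < q" "q dvd N" "0 < N" and H: "\<And>a. a \<in> H \<Longrightarrow> int q dvd a" and G: "\<And>a. a \<in> G \<Longrightarrow> \<not> int q dvd a"
    and mH: "moment_le N k H s" and mG: "moment_le N k G t"
  shows "moment_le N k (H \<union> G) (s + (real k)\<^sup>2 * t)"
proof -
  obtain y where y: "N = q * y" using q(2) by (auto elim: dvdE)
  then have "0 < y" using q(3) by simp
  define h g where "h = trig_poly N H" and "g = trig_poly N G"
  have "H \<inter> G = {}" using H G by blast
  then have sum: "trig_poly N (H \<union> G) x = h x + g x" for x
    using fin by (simp add: h_def g_def trig_poly_def sum.union_disjoint)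
  have h_periodic: "h (x + y) = h x" for x
    unfolding h_def trig_poly_def
  proof (intro sum.cong refl)
    fix a assume "a \<in> H"
    then have "character N a y = 1" using H character_eq_1_iff[of q y a] q \<open>0 < y\<close> y by simp
    then show "character N a (x + y) = character N a x" by (simp add: character_add_right)
  qed
  define W where "W x = complex_of_real (cmod (h x) ^ (2 * (k - 1))) * cnj (h x)" for x
  have "(\<Sum>x<N. W x * g x) = (\<Sum>a\<in>G. \<Sum>x<N. W x * character N a x)"
    by (simp add: g_def trig_poly_def sum_distrib_left sum.swap[of _ G])
  also have "\<dots> = 0"
    using y q \<open>0 < y\<close> G by (intro sum.neutral ballI sum_periodic_mult_character_eq_0[of N q y])
      (auto simp: W_def h_periodic)
  finally have W0: "(\<Sum>x<N. W x * g x) = 0" .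
  have pointwise: "cmod (h x + g x) ^ (2 * k) \<le>
      ((cmod (h x))\<^sup>2 + (real k)\<^sup>2 * (cmod (g x))\<^sup>2) ^ k + 2 * k * Re (W x * g x)" for x
  proof -
    let ?y = "2 * Re (cnj (h x) * g x)"
    have "\<bar>?y\<bar> \<le> 2 * cmod (h x) * cmod (g x)"
      using abs_Re_le_cmod[of "cnj (h x) * g x"] by (simp add: norm_mult)
    then have "((cmod (h x))\<^sup>2 + ?y + (cmod (g x))\<^sup>2) ^ k \<le>
        ((cmod (h x))\<^sup>2 + (real k)\<^sup>2 * (cmod (g x))\<^sup>2) ^ k + k * ((cmod (h x))\<^sup>2) ^ (k - 1) * ?y"
      using assms(5) by (intro power_le_first_order) auto
    also have "(cmod (h x))\<^sup>2 + ?y + (cmod (g x))\<^sup>2 = (cmod (h x + g x))\<^sup>2"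
      unfolding cmod_power2 by (simp add: power2_eq_square algebra_simps)
    also have "k * ((cmod (h x))\<^sup>2) ^ (k - 1) * ?y = 2 * k * Re (W x * g x)"
      by (simp add: W_def power_mult mult.assoc)
    finally show ?thesis by (simp add: power_mult)
  qed
  have "(\<Sum>x<N. cmod (h x + g x) ^ (2 * k)) \<le>
      (\<Sum>x<N. ((cmod (h x))\<^sup>2 + (real k)\<^sup>2 * (cmod (g x))\<^sup>2) ^ k + 2 * k * Re (W x * g x))"
    by (intro sum_mono pointwise)
  also have "\<dots> = (\<Sum>x<N. ((cmod (h x))\<^sup>2 + (real k)\<^sup>2 * (cmod (g x))\<^sup>2) ^ k) + 2 * k * Re (\<Sum>x<N. W x * g x)"
    by (simp add: sum.distrib sum_distrib_left)
  also have "\<dots> = (\<Sum>x<N. ((cmod (h x))\<^sup>2 + (real k)\<^sup>2 * (cmod (g x))\<^sup>2) ^ k)"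
    by (simp add: W0)
  also have "\<dots> \<le> N * (s + (real k)\<^sup>2 * t) ^ k"
  proof (rule sum_power_add_le)
    show "(\<Sum>x<N. ((cmod (h x))\<^sup>2) ^ k) \<le> N * s ^ k"
      using mH by (simp add: moment_le_def h_def power_mult)
    have "(\<Sum>x<N. ((real k)\<^sup>2 * (cmod (g x))\<^sup>2) ^ k) = ((real k)\<^sup>2) ^ k * (\<Sum>x<N. (cmod (g x)) ^ (2 * k))"
      by (simp only: power_mult_distrib power_mult sum_distrib_left)
    also have "\<dots> \<le> ((real k)\<^sup>2) ^ k * (N * t ^ k)"
      using mG by (intro mult_left_mono) (auto simp: moment_le_def g_def)
    also have "\<dots> = N * ((real k)\<^sup>2 * t) ^ k" by (simp only: power_mult_distrib mult_ac)
    finally show "(\<Sum>x<N. ((real k)\<^sup>2 * (cmod (g x))\<^sup>2) ^ k) \<le> N * ((real k)\<^sup>2 * t) ^ k" .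
  qed (use assms in auto)
  finally show ?thesis by (simp add: moment_le_def sum)
qed

text \<open>
  Elements are split off in increasing order of valuation: if $m$ is the smallest valuation, then
  $p^{m+1}$ divides all elements outside the fiber of $m$ and none inside it.
\<close>

lemma moment_le_fibers:
  fixes c :: real
  assumes "finite A" "A \<noteq> {}" "0 \<notin> A" "prime p" "1 \<le> k" "0 < c" "0 < N"
    and "\<And>a. a \<in> A \<Longrightarrow> a dvd int N"
    and "\<And>i. fiber p A i \<noteq> {} \<Longrightarrow> moment_le N k (fiber p A i) (c * card (fiber p A i))"
  shows "moment_le N k A ((real k)\<^sup>2 * c * card A)"
  using assms(1,2,3,8,9)
proof (induction "card A" arbitrary: A rule: less_induct)
  case less
  note A = less.prems
  define m where "m = Min (multiplicity p ` A)"
  define G H where "G = fiber p A m" and "H = A - G"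
  have m_le: "m \<le> multiplicity p a" if "a \<in> A" for a using A(1) that by (simp add: m_def)
  have "m \<in> multiplicity p ` A" unfolding m_def using A by (intro Min_in) auto
  then have G: "G \<noteq> {}" by (auto simp: G_def fiber_def)
  have GA: "G \<subseteq> A" and fin: "finite G" "finite H"
    using A(1) fiber_subset finite_subset[OF fiber_subset A(1)] by (auto simp: G_def H_def)
  have card: "card A = card H + card G" and cardG: "0 < card G"
    using card_Diff_subset[OF fin(1) GA] card_mono[OF A(1) GA] fin G by (simp_all add: H_def card_gt_0_iff)
  have k2: "1 \<le> (real k)\<^sup>2" using \<open>1 \<le> k\<close> by simp
  have mG: "moment_le N k G (c * card G)" using A(5)[of m] G by (simp add: G_def)
  show ?case
  proof (cases "H = {}")
    case True
    then have "A = G" using GA by (auto simp: H_def)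
    moreover have "c * card G * 1 \<le> c * card G * (real k)\<^sup>2"
      using k2 \<open>0 < c\<close> by (intro mult_left_mono) auto
    ultimately show ?thesis using moment_le_mono[OF mG, of "(real k)\<^sup>2 * c * card A"] \<open>0 < c\<close>
      by (simp add: mult_ac)
  next
    case False
    have mult_H: "Suc m \<le> multiplicity p a" if "a \<in> H" for a
      using that m_le[of a] by (auto simp: H_def G_def fiber_def)
    have fiber_H: "fiber p H i = (if i = m then {} else fiber p A i)" for i
      by (auto simp: H_def G_def fiber_def)
    have "moment_le N k H ((real k)\<^sup>2 * c * card H)"
    proof (rule less.hyps)
      show "card H < card A" using card cardG by simp
      show "finite H" "H \<noteq> {}" "0 \<notin> H" using fin False A(3) by (auto simp: H_def)
      show "a dvd int N" if "a \<in> H" for a using A(4) that by (simp add: H_def)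
      show "moment_le N k (fiber p H i) (c * card (fiber p H i))" if "fiber p H i \<noteq> {}" for i
        using that A(5)[of i] by (simp add: fiber_H split: if_splits)
    qed
    define q where "q = nat (p ^ Suc m)"
    have p: "1 < p" using \<open>prime p\<close> prime_gt_1_int by blast
    then have q: "int q = p ^ Suc m" by (simp add: q_def)
    have dvd_iff: "int q dvd a \<longleftrightarrow> Suc m \<le> multiplicity p a" if "a \<in> A" for a
      unfolding q using that A(3) p by (intro power_dvd_iff_le_multiplicity) auto
    have "moment_le N k (H \<union> G) ((real k)\<^sup>2 * c * card H + (real k)\<^sup>2 * (c * card G))"
    proof (rule moment_le_Un[where q = q])
      have "0 < int q" unfolding q using p by simp
      then show "0 < q" by simp
      show "int q dvd a" if "a \<in> H" for a using that mult_H dvd_iff[of a] by (simp add: H_def)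
      show "\<not> int q dvd a" if "a \<in> G" for a using that dvd_iff[of a] by (simp add: G_def fiber_def)
      obtain a where "a \<in> H" using False by auto
      then have "int q dvd a" "a dvd int N"
        using mult_H[of a] dvd_iff[of a] A(4)[of a] by (simp_all add: H_def)
      then have "int q dvd int N" by (rule dvd_trans)
      then show "q dvd N" by simp
      have "0 < card H" using fin False by (simp add: card_gt_0_iff)
      then show "0 < (real k)\<^sup>2 * c * card H" using \<open>1 \<le> k\<close> \<open>0 < c\<close> by simp
      show "0 < c * card G" using \<open>0 < c\<close> cardG by simp
    qed fact+
    moreover have "H \<union> G = A" using GA by (auto simp: H_def)
    moreover have "(real k)\<^sup>2 * c * card H + (real k)\<^sup>2 * (c * card G) = (real k)\<^sup>2 * c * card A"
      by (simp add: card algebra_simps)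
    ultimately show ?thesis by simp
  qed
qed

lemma moment_le_query_depth:
  assumes "query_depth_le t A" "finite A" "A \<noteq> {}" "0 \<notin> A" "1 \<le> k" "0 < N"
    and "\<And>a. a \<in> A \<Longrightarrow> a dvd int N"
  shows "moment_le N k A (2 * (real k ^ (2 * t)) * card A)"
  using assms(1-4,7)
proof (induction t arbitrary: A)
  case 0
  obtain a where a: "a \<in> A" using 0 by auto
  have "A \<subseteq> {a, - a}" using 0(1) a by (auto simp: abs_eq_iff)
  then have "card A \<le> card {a, - a}" by (intro card_mono) auto
  also have "\<dots> \<le> 2" by (simp add: card_insert_if)
  finally have 2: "card A \<le> 2" .
  have "cmod (trig_poly N A x) ^ (2 * k) \<le> (2 * real (card A)) ^ k" for x
  proof -
    have "cmod (trig_poly N A x) \<le> (\<Sum>a\<in>A. cmod (character N a x))"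
      unfolding trig_poly_def by (rule norm_sum)
    then have "cmod (trig_poly N A x) \<le> card A" by simp
    then have "(cmod (trig_poly N A x))\<^sup>2 \<le> real (card A) * card A" unfolding power2_eq_square by (intro mult_mono) auto
    also have "\<dots> \<le> 2 * real (card A)" using 2 by (intro mult_right_mono) auto
    finally have "((cmod (trig_poly N A x))\<^sup>2) ^ k \<le> (2 * real (card A)) ^ k" by (intro power_mono) auto
    then show ?thesis by (simp add: power_mult)
  qed
  then have "(\<Sum>x<N. cmod (trig_poly N A x) ^ (2 * k)) \<le> (\<Sum>x<N. (2 * real (card A)) ^ k)" by (intro sum_mono)
  then show ?case by (simp add: moment_le_def)
next
  case (Suc t)
  let ?c = "2 * (real k ^ (2 * t))"
  have c: "0 < ?c" using \<open>1 \<le> k\<close> by simp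
  have step: "(real k)\<^sup>2 * ?c * card A = 2 * (real k ^ (2 * Suc t)) * card A"
    by (simp add: power_add power2_eq_square)
  from Suc.prems(1) consider "query_depth_le t A"
    | p where "prime p" "\<And>i. query_depth_le t (fiber p A i)" by auto
  then show ?case
  proof cases
    case 1
    have "?c * card A * 1 \<le> ?c * card A * (real k)\<^sup>2"
      using \<open>1 \<le> k\<close> by (intro mult_left_mono) auto
    then show ?thesis
      using moment_le_mono[OF Suc.IH[OF 1 Suc.prems(2-)], of "(real k)\<^sup>2 * ?c * card A"] c
      unfolding step[symmetric] by (simp add: mult_ac)
  next
    case 2
    have "moment_le N k A ((real k)\<^sup>2 * ?c * card A)"
    proof (rule moment_le_fibers[OF Suc.prems(2-4) 2(1) \<open>1 \<le> k\<close> c \<open>0 < N\<close> Suc.prems(5)])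
      fix i assume "fiber p A i \<noteq> {}"
      then show "moment_le N k (fiber p A i) (?c * card (fiber p A i))"
        using 2(2)[of i] finite_subset[OF fiber_subset Suc.prems(2)] Suc.prems(4,5)
        by (intro Suc.IH) (auto simp: fiber_def)
    qed
    then show ?thesis unfolding step .
  qed
qed

text \<open>
  The $k$-th power of the exponential sum is $\sum_u r(u) e(ux/N)$ with $u$ ranging over $kA$; the sum
  of the coefficients is $|A|^k$, by evaluation at $x = 0$.  Since distinct elements of $kA$ are
  incongruent, the normalised moment is the sum of the $r(u)^2$, and the Cauchy-Schwarz inequality
  applies.
\<close>

lemma card_power_le_sumset_moment:
  fixes s :: real
  assumes "finite A" "0 < N" "moment_le N k A s"
    and inj: "\<And>u v. u \<in> sumset k A \<Longrightarrow> v \<in> sumset k A \<Longrightarrow> u \<noteq> v \<Longrightarrow> \<not> int N dvd u - v"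
  shows "real (card A) ^ (2 * k) \<le> card (sumset k A) * s ^ k"
proof -
  obtain r :: "int \<Rightarrow> real"
    where r: "\<And>x. trig_poly N A x ^ k = (\<Sum>u\<in>sumset k A. r u * character N u x)"
    using trig_poly_power[OF assms(1), of N k] by blast
  have "complex_of_real (real (card A) ^ k) = complex_of_real (\<Sum>u\<in>sumset k A. r u)"
    using r[of 0] by (simp add: trig_poly_def)
  then have total: "real (card A) ^ k = (\<Sum>u\<in>sumset k A. r u)" by (simp only: of_real_eq_iff)
  have "N * (\<Sum>u\<in>sumset k A. (r u)\<^sup>2) = (\<Sum>x<N. (cmod (trig_poly N A x ^ k))\<^sup>2)"
    unfolding r using finite_sumset[OF assms(1)] assms(2) inj by (rule sum_norm_sq_trig_sum[symmetric])
  also have "\<dots> = (\<Sum>x<N. cmod (trig_poly N A x) ^ (2 * k))"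
    by (simp add: norm_power mult.commute flip: power_mult)
  also have "\<dots> \<le> N * s ^ k" using assms(3) by (simp add: moment_le_def)
  finally have "(\<Sum>u\<in>sumset k A. (r u)\<^sup>2) \<le> s ^ k" using \<open>0 < N\<close> by simp
  then have "card (sumset k A) * (\<Sum>u\<in>sumset k A. (r u)\<^sup>2) \<le> card (sumset k A) * s ^ k"
    by (intro mult_left_mono) auto
  moreover have "(\<Sum>u\<in>sumset k A. r u)\<^sup>2 \<le> card (sumset k A) * (\<Sum>u\<in>sumset k A. (r u)\<^sup>2)"
    using sum_squared_le_sum_of_squares[of r "sumset k A"] by (simp add: mult.commute)
  ultimately have "(real (card A) ^ k)\<^sup>2 \<le> card (sumset k A) * s ^ k" unfolding total by linarith
  then show ?thesis by (simp add: mult.commute flip: power_mult)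
qed

lemma card_sumset_ge_query_depth:
  assumes "query_depth_le t A" "finite A" "A \<noteq> {}" "0 \<notin> A" "1 \<le> k"
  shows "real (card A) ^ k \<le> card (sumset k A) * (2 * real k ^ (2 * t)) ^ k"
proof -
  define M where "M = Suc (\<Sum>a\<in>A \<union> sumset k A. 2 * nat \<bar>a\<bar>)"
  define N where "N = (fact M :: nat)"
  have fin: "finite (A \<union> sumset k A)" using assms finite_sumset by blast
  have bound: "2 * nat \<bar>a\<bar> < M" if "a \<in> A \<union> sumset k A" for a
    unfolding M_def less_Suc_eq_le using fin that by (intro member_le_sum) auto
  have NM: "M \<le> N" "0 < N" by (simp_all add: N_def fact_ge_self)
  have dvdN: "a dvd int N" if "a \<in> A" for a
  proof -
    have "a \<noteq> 0" using assms that by auto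
    then have "nat \<bar>a\<bar> dvd N" unfolding N_def using bound[of a] that by (intro dvd_fact) auto
    then show ?thesis using int_dvd_int_iff[of "nat \<bar>a\<bar>" N] by simp
  qed
  have inj: "\<not> int N dvd u - v" if "u \<in> sumset k A" "v \<in> sumset k A" "u \<noteq> v" for u v
  proof
    assume "int N dvd u - v"
    then have "int N \<le> \<bar>u - v\<bar>" using that by (intro zdvd_imp_le) auto
    moreover have "2 * \<bar>u\<bar> < int M" "2 * \<bar>v\<bar> < int M" using bound[of u] bound[of v] that by auto
    ultimately show False using NM by linarith
  qed
  have "moment_le N k A (2 * real k ^ (2 * t) * card A)"
    using assms NM(2) dvdN by (rule moment_le_query_depth)
  with assms(2) NM(2) have "real (card A) ^ (2 * k) \<le> card (sumset k A) * (2 * real k ^ (2 * t) * card A) ^ k"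
    using inj by (rule card_power_le_sumset_moment)
  then have "real (card A) ^ k * real (card A) ^ k \<le>
      (card (sumset k A) * (2 * real k ^ (2 * t)) ^ k) * real (card A) ^ k"
    unfolding power_mult_distrib[of _ "real (card A)"] mult_2[of k] power_add by (simp only: mult.assoc)
  moreover have "0 < real (card A) ^ k" using assms by (simp add: card_gt_0_iff)
  ultimately show ?thesis by (rule mult_right_le_imp_le)
qed

section \<open>From products to sums\<close>

lemma sumset_mono: "B \<subseteq> A \<Longrightarrow> sumset k B \<subseteq> sumset k A"
  unfolding sumset_altdef by blast

lemma card_le_card_sumset:
  fixes A :: "'a::cancel_comm_monoid_add set"
  assumes "finite A" "A \<noteq> {}" "1 \<le> k"
  shows "card A \<le> card (sumset k A)"
proof -
  obtain j where k: "k = Suc j" using assms(3) by (cases k) auto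
  obtain a where a: "a \<in> A" using assms by auto
  have "(\<Sum>i = 1..j. a) \<in> sumset j A" unfolding sumset_altdef using a by blast
  then have "(\<lambda>b. (\<Sum>i = 1..j. a) + b) ` A \<subseteq> sumset k A" by (auto simp: k sumset_def)
  then have "card ((\<lambda>b. (\<Sum>i = 1..j. a) + b) ` A) \<le> card (sumset k A)"
    using finite_sumset[OF assms(1)] by (intro card_mono)
  then show ?thesis by (simp add: card_image)
qed

lemma card_sumset_ge_nonzero:
  fixes A :: "int set"
  assumes A: "finite A" "A \<noteq> {}" "0 \<notin> A" and \<epsilon>: "0 < \<epsilon>" "\<epsilon> \<le> 1/4" and k: "1 \<le> k"
    and K: "K = real (card (A * A)) / card A"
  shows "(1/2) ^ k * card A powr (k - 2 * \<epsilon> * k * log 2 k) * K powr (- (2 * real k / \<epsilon>)) \<le> card (sumset k A)"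
proof -
  let ?n = "real (card A)"
  define L where "L = ?n powr (2 * \<epsilon> * k * log 2 k)"
  have n: "1 \<le> ?n" using A by (simp add: card_gt_0_iff Suc_le_eq)
  have K0: "0 \<le> K" by (simp add: K)
  obtain B where B: "B \<subseteq> A" "query_depth_le (budget \<epsilon> A) B" "?n * K powr (- (2 / \<epsilon>)) \<le> card B"
    using exists_large_subset_query_depth_le[OF A \<epsilon> K] by blast
  have finB: "finite B" using B(1) A(1) by (rule finite_subset)
  show ?thesis
  proof (cases "B = {}")
    case True
    then have "K powr (- (2 / \<epsilon>)) \<le> 0" using B(3) n by (simp add: mult_le_0_iff)
    then have "K = 0" using K0 by simp
    then show ?thesis by simp
  next
    case False
    let ?t = "budget \<epsilon> A"
    have t: "real ?t \<le> \<epsilon> * log 2 ?n" using n \<epsilon> by (simp add: budget_def)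
    have "(real k ^ (2 * ?t)) ^ k = real k powr (2 * real k * ?t)"
      using k powr_realpow[of "real k" "2 * k * ?t"] by (simp add: mult_ac flip: power_mult)
    also have "\<dots> \<le> real k powr (2 * real k * (\<epsilon> * log 2 ?n))"
      using k t by (intro powr_mono mult_left_mono) auto
    also have "\<dots> = L"
      using k n by (simp add: L_def powr_def log_def mult_ac)
    finally have L: "(real k ^ (2 * ?t)) ^ k \<le> L" .
    have Lpos: "0 < L" using n by (simp add: L_def)
    have "(?n * K powr (- (2 / \<epsilon>))) ^ k \<le> real (card B) ^ k" using B(3) by (intro power_mono) auto
    also have "\<dots> \<le> card (sumset k B) * (2 * real k ^ (2 * ?t)) ^ k"
      using B(1) A(3) by (intro card_sumset_ge_query_depth[OF B(2) finB False _ k]) auto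
    also have "\<dots> \<le> card (sumset k A) * (2 * real k ^ (2 * ?t)) ^ k"
      using card_mono[OF finite_sumset[OF A(1)] sumset_mono[OF B(1)]] by (intro mult_right_mono) auto
    also have "\<dots> \<le> card (sumset k A) * (2 ^ k * L)"
      using L by (simp add: power_mult_distrib mult_left_mono)
    finally have "(1/2) ^ k * (?n * K powr (- (2 / \<epsilon>))) ^ k / L \<le> card (sumset k A)"
      using Lpos by (simp add: field_simps)
    moreover have "(?n * K powr (- (2 / \<epsilon>))) ^ k / L =
        ?n powr (k - 2 * \<epsilon> * k * log 2 k) * K powr (- (2 * real k / \<epsilon>))"
    proof -
      have "(K powr (- (2 / \<epsilon>))) ^ k = K powr (- (2 * real k / \<epsilon>))"
        using k by (cases "K = 0") (simp_all add: powr_power mult.commute)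
      then have "(?n * K powr (- (2 / \<epsilon>))) ^ k = ?n powr k * K powr (- (2 * real k / \<epsilon>))"
        using n by (simp add: power_mult_distrib powr_realpow)
      then show ?thesis by (simp add: powr_diff L_def)
    qed
    ultimately show ?thesis by (simp add: mult.assoc flip: times_divide_eq_right)
  qed
qed

text \<open>
  Zero has to be removed, which increases the ratio $|AA|/|A|$ by at most the factor
  $|A|/(|A|-1) \le e^{1/(|A|-1)}$.  Its power $2k/\epsilon$ is bounded because
  $1/\epsilon \le \log_2|A| \le |A|-1$.
\<close>

lemma card_sumset_ge_of_log_bound:
  fixes A :: "int set"
  assumes A: "finite A" "2 \<le> card A" and \<epsilon>: "1 / log 2 (card A) \<le> \<epsilon>" "\<epsilon> \<le> 1/4" and k: "1 \<le> k"
    and K: "K = real (card (A * A)) / card A"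
  shows "(1/36) ^ k * card A powr (k - 2 * \<epsilon> * k * log 2 k) * K powr (- (2 * real k / \<epsilon>)) \<le> card (sumset k A)"
proof -
  define e where "e = k - 2 * \<epsilon> * k * log 2 k"
  define B where "B = A - {0}"
  define n m where "n = real (card A)" and "m = real (card B)"
  define K' where "K' = real (card (B * B)) / card B"
  have finB: "finite B" using A by (simp add: B_def)
  have n: "2 \<le> n" using A(2) by (simp add: n_def)
  have m: "n - 1 \<le> m" "m \<le> n" using A(1) by (auto simp: n_def m_def B_def card_Diff_singleton_if)
  have m1: "1 \<le> m" "1/2 \<le> m / n" "m / n \<le> 1" using n m by (simp_all add: field_simps)
  have log_pos: "0 < log 2 n" using n by simp
  then have "0 < 1 / log 2 n" by simp
  then have \<epsilon>0: "0 < \<epsilon>" using \<epsilon>(1) unfolding n_def by linarith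
  have neB: "B \<noteq> {}" using m1(1) by (auto simp: m_def)
  then obtain b where b: "b \<in> B" "b \<noteq> 0" by (auto simp: B_def)
  have K'1: "1 \<le> K'" using card_set_times_ge[OF finB finB b] m1(1) by (simp add: K'_def m_def)
  have "1 \<le> \<epsilon> * m"
  proof -
    have "card A \<le> 2 ^ (card A - 1)" using less_exp[of "card A - 1"] A(2) by linarith
    then have "real (card A) \<le> real (2 ^ (card A - 1))" by (rule of_nat_mono)
    then have "n \<le> 2 ^ (card A - 1)" by (simp add: n_def)
    then have "log 2 n \<le> card A - 1" using n by (simp add: log_le_iff powr_realpow)
    then have "log 2 n \<le> m" using m A(2) by (simp add: n_def of_nat_diff)
    then have "\<epsilon> * log 2 n \<le> \<epsilon> * m" using \<epsilon>0 by (intro mult_left_mono) auto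
    moreover have "1 \<le> \<epsilon> * log 2 n" using \<epsilon>(1) log_pos by (simp add: n_def field_simps)
    ultimately show ?thesis by linarith
  qed
  then have \<epsilon>m: "1 / (\<epsilon> * m) \<le> 1" by simp
  have "n / m \<le> 1 + 1 / m" using m m1(1) by (simp add: field_simps)
  also have "\<dots> \<le> exp (1 / m)" by (rule exp_ge_add_one_self)
  finally have "(n / m) powr (2 * real k / \<epsilon>) \<le> exp (1 / m) powr (2 * real k / \<epsilon>)"
    using n m1 \<epsilon>0 by (intro powr_mono2) auto
  also have "\<dots> = exp (2 * real k * (1 / (\<epsilon> * m)))" by (simp add: powr_def mult_ac)
  also have "\<dots> \<le> exp (2 * real k)" using mult_left_mono[OF \<epsilon>m, of "2 * real k"] by simp
  also have "\<dots> = (exp 1 * exp 1) ^ k" by (simp add: exp_add[symmetric] exp_of_nat_mult[symmetric] mult.commute)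
  also have "\<dots> \<le> (3 * 3) ^ k" using exp_le by (intro power_mono mult_mono) auto
  finally have ratio: "(n / m) powr (2 * real k / \<epsilon>) \<le> 9 ^ k" by simp
  have "K' \<le> K * (n / m)"
  proof -
    have "card (B * B) \<le> card (A * A)"
      using A(1) by (intro card_mono finite_set_times) (auto simp: B_def set_times_mono2)
    then show ?thesis using n m1 by (simp add: K'_def K n_def m_def divide_right_mono)
  qed
  then have "K' powr (2 * real k / \<epsilon>) \<le> (K * (n / m)) powr (2 * real k / \<epsilon>)"
    using K'1 \<epsilon>0 by (intro powr_mono2) auto
  also have "\<dots> = K powr (2 * real k / \<epsilon>) * (n / m) powr (2 * real k / \<epsilon>)"
    by (rule powr_mult)
  also have "\<dots> \<le> K powr (2 * real k / \<epsilon>) * 9 ^ k" using ratio by (intro mult_left_mono) auto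
  finally have "K' powr (2 * real k / \<epsilon>) \<le> K powr (2 * real k / \<epsilon>) * 9 ^ k" .
  moreover have "0 < K' powr (2 * real k / \<epsilon>)" using K'1 by simp
  moreover have "0 < K"
  proof -
    have "0 < K * (n / m)" using \<open>K' \<le> K * (n / m)\<close> K'1 by linarith
    then show ?thesis using n m1 by (simp add: zero_less_mult_iff zero_less_divide_iff)
  qed
  ultimately have Kbound: "(1/9) ^ k * K powr (- (2 * real k / \<epsilon>)) \<le> K' powr (- (2 * real k / \<epsilon>))"
    by (simp add: powr_minus power_divide field_simps)
  have "e \<le> k" using \<epsilon>0 k by (simp add: e_def)
  have "(1/2) ^ k \<le> (m / n) powr e"
  proof -
    have "(1/2) ^ k \<le> (m / n) ^ k" using m1 by (intro power_mono) auto
    also have "\<dots> = (m / n) powr k" using m1 n by (simp add: powr_realpow)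
    also have "\<dots> \<le> (m / n) powr e" using m1 n \<open>e \<le> k\<close> by (intro powr_mono') auto
    finally show ?thesis .
  qed
  then have nbound: "(1/2) ^ k * n powr e \<le> m powr e"
    using n m1 by (simp add: powr_divide field_simps)
  have "(1/36) ^ k * n powr e * K powr (- (2 * real k / \<epsilon>)) =
      (1/2) ^ k * ((1/2) ^ k * n powr e) * ((1/9) ^ k * K powr (- (2 * real k / \<epsilon>)))"
    by (simp flip: power_mult_distrib)
  also have "\<dots> \<le> (1/2) ^ k * m powr e * K' powr (- (2 * real k / \<epsilon>))"
    using nbound Kbound by (intro mult_mono mult_left_mono) auto
  also have "\<dots> \<le> card (sumset k B)"
    unfolding m_def e_def using finB neB \<epsilon>0 \<epsilon>(2) k K'_def by (intro card_sumset_ge_nonzero) (auto simp: B_def)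
  also have "\<dots> \<le> card (sumset k A)"
    using A(1) by (intro of_nat_mono card_mono finite_sumset sumset_mono) (auto simp: B_def)
  finally show ?thesis by (simp add: e_def n_def)
qed

text \<open>
  The exponent of $|A|$ at $\epsilon = 1/4$, with equality for $k = 1$ and $k = 2$.  For larger
  $\epsilon$ the lower bound is therefore no more than $|A|$.
\<close>

lemma mult_one_minus_half_log_le_1:
  assumes "1 \<le> k"
  shows "real k * (1 - log 2 k / 2) \<le> 1"
proof -
  consider "k = 1" | "k = 2" | "k = 3" | "4 \<le> k" using assms by linarith
  then show ?thesis
  proof cases
    case 3
    have "(4::real) \<le> 3 * log 2 3"
    proof -
      have "log 2 (2 ^ 4) \<le> log 2 (3 ^ 3 :: real)" by (intro log_mono) auto
      then show ?thesis by (simp add: log_nat_power del: power_numeral)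
    qed
    then show ?thesis using 3 by simp
  next
    case 4
    have "log 2 (2 ^ 2) \<le> log 2 (real k)" using 4 by (intro log_mono) auto
    then have "2 \<le> log 2 (real k)" by (simp add: log_nat_power del: power_numeral)
    then have "real k * (1 - log 2 k / 2) \<le> 0" by (intro mult_nonneg_nonpos) auto
    then show ?thesis by simp
  qed simp_all
qed

lemma card_le_card_set_times:
  fixes A :: "int set"
  assumes "finite A" "A \<noteq> {}"
  shows "card A \<le> card (A * A)"
proof (cases "A = {0}")
  case True
  then show ?thesis by (simp add: set_times_def)
next
  case False
  then obtain a where "a \<in> A" "a \<noteq> 0" using assms(2) by auto
  then show ?thesis using assms(1) by (intro card_set_times_ge)
qed

theorem theorem1p2:
  fixes k :: nat
  assumes "k \<ge> 1"
  shows "\<exists>c::real. c > 0 \<and>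
    (\<forall>(\<epsilon>::real) (A::int set).
      0 < \<epsilon> \<longrightarrow> \<epsilon> < 1 \<longrightarrow> finite A \<longrightarrow> A \<noteq> {} \<longrightarrow>
      (let K = real (card (A * A)) / real (card A) in
        real (card (sumset k A)) \<ge>
          c * real (card A) powr (real k - 2 * \<epsilon> * real k * log 2 (real k))
            * K powr (- (2 * real k / \<epsilon>))))"
proof -
  \<comment> \<open>The factor 36 comes from \<open>card_sumset_ge_of_log_bound\<close>; the square of \<open>k\<close> pays for raising \<open>\<epsilon>\<close>.\<close>
  define c where "c = (1 / (36 * (real k)\<^sup>2)) ^ k"
  have k: "1 \<le> real k" using assms by simp
  have k2: "1 \<le> (real k)\<^sup>2" using k by simp
  have c0: "0 < c" using k by (simp add: c_def)
  have logk: "0 \<le> log 2 k" using k by simp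
  have main: "c * card A powr (k - 2 * \<epsilon> * k * log 2 k) * K powr (- (2 * real k / \<epsilon>)) \<le> card (sumset k A)"
    if \<epsilon>: "0 < \<epsilon>" "\<epsilon> < 1" and A: "finite A" "A \<noteq> {}" and K: "K = real (card (A * A)) / card A"
    for \<epsilon> K :: real and A :: "int set"
  proof -
    define n where "n = real (card A)"
    define e where "e = k - 2 * \<epsilon> * k * log 2 k"
    have n: "1 \<le> n" using A by (simp add: n_def card_gt_0_iff Suc_le_eq)
    have n_le: "n \<le> card (sumset k A)" using card_le_card_sumset[OF A assms] by (simp add: n_def)
    have K1: "1 \<le> K" using card_le_card_set_times[OF A] n by (simp add: K n_def)
    then have Kneg: "K powr (- (2 * real k / \<epsilon>)) \<le> 1"
      using \<epsilon> powr_mono[of "- (2 * real k / \<epsilon>)" 0 K] by simp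
    have trivial: "c * n powr e * K powr (- (2 * real k / \<epsilon>)) \<le> c * n powr e"
      using mult_left_mono[OF Kneg, of "c * n powr e"] c0 by simp
    have c_le: "c \<le> (1 / 36) ^ k"
      unfolding c_def using k k2 by (intro power_mono divide_left_mono) auto
    consider "e \<le> 1" | "n < 16" | "1 < e" "16 \<le> n" by linarith
    then show ?thesis
    proof cases
      case 1
      have "c \<le> 1" using c_le power_le_one[of "1/36 :: real" k] by simp
      moreover have "n powr e \<le> n" using powr_mono[OF 1 n] n by simp
      ultimately have "c * n powr e \<le> 1 * n" using c0 by (intro mult_mono) auto
      then show ?thesis using trivial n_le unfolding n_def e_def by linarith
    next
      case 2
      have "e \<le> k" using \<epsilon> logk k by (simp add: e_def)
      then have "n powr e \<le> n powr k" using n by (intro powr_mono)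
      also have "\<dots> = n ^ k" using n by (simp add: powr_realpow)
      also have "\<dots> \<le> 36 ^ k" using 2 n by (intro power_mono) auto
      finally have "c * n powr e \<le> (1 / 36) ^ k * 36 ^ k" using c0 c_le by (intro mult_mono) auto
      also have "\<dots> = 1" by (simp flip: power_mult_distrib)
      finally show ?thesis using trivial n_le n unfolding n_def e_def by linarith
    next
      case 3
      have "\<epsilon> \<le> 1/4"
      proof (rule ccontr)
        assume "\<not> \<epsilon> \<le> 1/4"
        then have "1/4 * (2 * real k * log 2 k) \<le> \<epsilon> * (2 * real k * log 2 k)"
          using logk k by (intro mult_right_mono) auto
        then have "e \<le> k * (1 - log 2 k / 2)" by (simp add: e_def algebra_simps)
        then show False using mult_one_minus_half_log_le_1[OF assms] 3 by linarith
      qed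
      \<comment> \<open>Very small parameters are raised to \<open>1 / log 2 n\<close>.\<close>
      define \<epsilon>' where "\<epsilon>' = max \<epsilon> (1 / log 2 n)"
      define e' where "e' = k - 2 * \<epsilon>' * k * log 2 k"
      have "log 2 (2 ^ 4) \<le> log 2 n" using 3 by (intro log_mono) auto
      then have log4: "4 \<le> log 2 n" by (simp add: log_nat_power del: power_numeral)
      have \<epsilon>': "\<epsilon> \<le> \<epsilon>'" "1 / log 2 n \<le> \<epsilon>'" "\<epsilon>' \<le> 1/4" "\<epsilon>' - \<epsilon> \<le> 1 / log 2 n"
      proof -
        have "0 \<le> 1 / log 2 n" "1 / log 2 n \<le> 1 / 4" using log4 by (simp_all add: field_simps)
        then show "\<epsilon> \<le> \<epsilon>'" "1 / log 2 n \<le> \<epsilon>'" "\<epsilon>' \<le> 1/4" "\<epsilon>' - \<epsilon> \<le> 1 / log 2 n"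
          using \<open>\<epsilon> \<le> 1/4\<close> \<epsilon>(1) unfolding \<epsilon>'_def by (cases "\<epsilon> \<le> 1 / log 2 n"; simp)+
      qed
      have "e - e' = 2 * real k * log 2 k * (\<epsilon>' - \<epsilon>)" by (simp add: e_def e'_def algebra_simps)
      also have "\<dots> \<le> 2 * real k * log 2 k * (1 / log 2 n)"
        using \<epsilon>'(4) logk by (intro mult_left_mono) auto
      finally have "n powr (e - e') \<le> n powr (2 * real k * log 2 k * (1 / log 2 n))"
        using n by (intro powr_mono)
      also have "\<dots> = ((real k)\<^sup>2) ^ k"
      proof -
        have "n powr (2 * real k * log 2 k * (1 / log 2 n)) = real k powr (2 * real k)"
          using k log4 3 by (simp add: powr_def log_def)
        also have "\<dots> = real k ^ (2 * k)" using k powr_realpow[of "real k" "2 * k"] by simp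
        finally show ?thesis by (simp add: power_mult)
      qed
      finally have "n powr e \<le> ((real k)\<^sup>2) ^ k * n powr e'"
        using n by (simp add: powr_diff field_simps)
      moreover have "K powr (- (2 * real k / \<epsilon>)) \<le> K powr (- (2 * real k / \<epsilon>'))"
        using K1 \<epsilon> \<epsilon>'(1) by (intro powr_mono) (auto intro: divide_left_mono)
      ultimately have "c * (n powr e * K powr (- (2 * real k / \<epsilon>))) \<le>
          c * (((real k)\<^sup>2) ^ k * n powr e' * K powr (- (2 * real k / \<epsilon>')))"
        using c0 by (intro mult_left_mono mult_mono) auto
      also have "\<dots> = (c * ((real k)\<^sup>2) ^ k) * n powr e' * K powr (- (2 * real k / \<epsilon>'))" by simp
      also have "c * ((real k)\<^sup>2) ^ k = (1 / 36) ^ k"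
        using k by (simp add: c_def flip: power_mult_distrib)
      also have "(1 / 36) ^ k * n powr e' * K powr (- (2 * real k / \<epsilon>')) \<le> card (sumset k A)"
        unfolding n_def e'_def using A(1) 3 \<epsilon>' assms K
        by (intro card_sumset_ge_of_log_bound) (auto simp: n_def)
      finally show ?thesis by (simp add: n_def e_def mult.assoc)
    qed
  qed
  show ?thesis
    unfolding Let_def using c0 main by (intro exI[of _ c] conjI allI impI) auto
qed

end
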